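(* Let $f\colon S^2\to S^2$ be an expanding Thurston map without periodic critical points. Then the measure-theoretic entropy $h_\mu(f)$, considered as a function of $\mu$ on the space $\mathcal{M}(S^2,f)$ of $f$-invariant Borel probability measures equipped with the weak$^*$ topology, is upper semi-continuous.
   Context: Conventions: $\mathbb{N}=\{1,2,3,\dots\}$, $\mathbb{N}_0=\mathbb{N}\cup\{0\}$; $S^2$ is an oriented topological $2$-sphere. $h_\mu(f)$ denotes the usual measure-theoretic (Kolmogorov–Sinai) entropy. A function $h\colon X\to[-\infty,+\infty]$ on a metric space $X$ is upper semi-continuous if $\limsup_{y\to x}h(y)\le h(x)$ for all $x\in X$. Expanding Thurston maps: A continuous map $f\colon S^2\to S^2$ is a branched covering map if for each $x\in S^2$ there exist $d\in\mathbb{N}$ (the local degree of $f$ at $x$, denoted $\deg_f(x)$), open neighborhoods $U$ of $x$ and $V$ of $y=f(x)$, open neighborhoods $U',V'$ of $0$ in $\widehat{\mathbb{C}}$, and orientation-preserving homeomorphisms $\varphi\colon U\to U'$, $\eta\colon V\to V'$ with $\varphi(x)=0$, $\eta(y)=0$ and $(\eta\circ f\circ\varphi^{-1})(z)=z^d$ for all $z\in U'$. The degree is $\deg f=\sum_{x\in f^{-1}(y)}\deg_f(x)$ (independent of $y$). A point $x$ is a critical point if $\deg_f(x)\ge 2$; $\operatorname{crit} f$ is the set of critical points, and $\operatorname{post} f=\{f^n(x) : x\in\operatorname{crit} f,\ n\in\mathbb{N}\}$. A Thurston map is a branched covering map with $\deg f\ge2$ and $\operatorname{post} f$ finite. For a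 Jordan curve $\mathcal{C}\subseteq S^2$ with $\operatorname{post} f\subseteq\mathcal{C}$, the $n$-tiles ($n\in\mathbb{N}_0$) are the closures of the connected components of $S^2\setminus f^{-n}(\mathcal{C})$. A Thurston map $f$ is expanding if there exist a metric $d$ on $S^2$ inducing the standard topology and a Jordan curve $\mathcal{C}\supseteq\operatorname{post} f$ such that the maximal $d$-diameter of $n$-tiles tends to $0$ as $n\to+\infty$. A periodic critical point is a critical point $x$ with $f^n(x)=x$ for some $n\in\mathbb{N}$. *)

theory Defs
  imports "HOL-Probability.Probability" "HOL-Homology.Homology"
begin

section \<open>Orientations of topological 2-spheres\<close>

text \<open>
  An orientation of a topological 2-sphere is a generator of its second homology group (an
  infinite cyclic group). Its image in the relative homology of the pair \<open>(X, X - {x})\<close> is the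
  induced local orientation at \<open>x\<close>.
\<close>

definition is_orientation :: "'a topology \<Rightarrow> 'a chain set \<Rightarrow> bool" where
  "is_orientation X \<omega> \<longleftrightarrow>
     \<omega> \<in> carrier (homology_group 2 X) \<and>
     subgroup_generated (homology_group 2 X) {\<omega>} = homology_group 2 X"

definition oriented_2_sphere :: "'a topology \<Rightarrow> 'a chain set \<Rightarrow> bool" where
  "oriented_2_sphere X \<omega> \<longleftrightarrow> X homeomorphic_space nsphere 2 \<and> is_orientation X \<omega>"

definition local_orientation :: "'a topology \<Rightarrow> 'a chain set \<Rightarrow> 'a \<Rightarrow> 'a chain set" where
  "local_orientation X \<omega> x = hom_induced 2 X {} X (topspace X - {x}) id \<omega>"

text \<open>
  A homeomorphism between open subsets \<open>U\<close> of \<open>X\<close> and \<open>V\<close> of \<open>Y\<close> preserves orientation if it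
  carries the local orientation of \<open>X\<close> at every \<open>x \<in> U\<close> to that of \<open>Y\<close> at \<open>\<phi> x\<close>. By excision the
  local homology of \<open>X\<close> at \<open>x\<close> is that of \<open>(U, U - {x})\<close>; the class \<open>c\<close> below is the one
  corresponding to the local orientation of \<open>X\<close>.
\<close>

definition orientation_preserving_homeomorphism ::
  "'a topology \<Rightarrow> 'a chain set \<Rightarrow> 'a set \<Rightarrow> 'b topology \<Rightarrow> 'b chain set \<Rightarrow> 'b set \<Rightarrow> ('a \<Rightarrow> 'b) \<Rightarrow> bool"
where
  "orientation_preserving_homeomorphism X \<omega> U Y \<omega>' V \<phi> \<longleftrightarrow>
     homeomorphic_map (subtopology X U) (subtopology Y V) \<phi> \<and>
     (\<forall>x\<in>U. \<exists>c \<in> carrier (relative_homology_group 2 (subtopology X U) (U - {x})).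
        hom_induced 2 (subtopology X U) (U - {x}) X (topspace X - {x}) id c
          = local_orientation X \<omega> x \<and>
        hom_induced 2 (subtopology X U) (U - {x}) Y (topspace Y - {\<phi> x}) \<phi> c
          = local_orientation Y \<omega>' (\<phi> x))"

section \<open>The Riemann sphere\<close>

text \<open>\<open>None\<close> is the point at infinity.\<close>

definition riemann_sphere :: "complex option topology" where
  "riemann_sphere = Alexandroff_compactification euclidean"

definition rs_power :: "nat \<Rightarrow> complex option \<Rightarrow> complex option" where
  "rs_power d = map_option (\<lambda>z. z ^ d)"

text \<open>
  The singular 2-simplex mapping the standard simplex affinely onto the triangle whose vertices
  are the cube roots of unity, in counterclockwise order. Its class generates the local homology
  at \<open>0\<close>; the standard orientation of the Riemann sphere is the one inducing this class.
\<close>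

definition positive_triangle :: "(nat \<Rightarrow> real) \<Rightarrow> complex option" where
  "positive_triangle =
     restrict (\<lambda>t. Some (\<Sum>k\<le>2. of_real (t k) * cis (2 * pi * real k / 3))) (standard_simplex 2)"

definition rs_orientation :: "complex option chain set" where
  "rs_orientation = (THE \<omega>. is_orientation riemann_sphere \<omega> \<and>
     local_orientation riemann_sphere \<omega> (Some 0) =
       homologous_rel_set 2 riemann_sphere (topspace riemann_sphere - {Some 0})
         (frag_of positive_triangle))"

section \<open>Branched covering maps and Thurston maps\<close>

text \<open>
  In what follows the sphere is the whole type \<open>'a\<close>, and \<open>\<omega>\<close> is its orientation.
\<close>

definition has_local_degree ::
  "('a::topological_space) chain set \<Rightarrow> ('a \<Rightarrow> 'a) \<Rightarrow> 'a \<Rightarrow> nat \<Rightarrow> bool" where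
  "has_local_degree \<omega> f x d \<longleftrightarrow> d \<ge> 1 \<and>
     (\<exists>U V U' V' \<phi> \<eta>.
        open U \<and> x \<in> U \<and> open V \<and> f x \<in> V \<and> f ` U \<subseteq> V \<and>
        openin riemann_sphere U' \<and> Some 0 \<in> U' \<and>
        openin riemann_sphere V' \<and> Some 0 \<in> V' \<and>
        orientation_preserving_homeomorphism euclidean \<omega> U riemann_sphere rs_orientation U' \<phi> \<and>
        orientation_preserving_homeomorphism euclidean \<omega> V riemann_sphere rs_orientation V' \<eta> \<and>
        \<phi> x = Some 0 \<and> \<eta> (f x) = Some 0 \<and>
        (\<forall>z\<in>U'. (\<eta> \<circ> f \<circ> inv_into U \<phi>) z = rs_power d z))"

definition branched_covering :: "('a::topological_space) chain set \<Rightarrow> ('a \<Rightarrow> 'a) \<Rightarrow> bool" where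
  "branched_covering \<omega> f \<longleftrightarrow>
     continuous_on UNIV f \<and> (\<forall>x. \<exists>d. has_local_degree \<omega> f x d)"

text \<open>
  For a branched covering map of a 2-sphere the local degree at each point is unique, fibres are
  finite, and the sum of local degrees over a fibre is independent of the fibre.
\<close>

definition local_degree ::
  "('a::topological_space) chain set \<Rightarrow> ('a \<Rightarrow> 'a) \<Rightarrow> 'a \<Rightarrow> nat" where
  "local_degree \<omega> f x = (THE d. has_local_degree \<omega> f x d)"

definition map_degree :: "('a::topological_space) chain set \<Rightarrow> ('a \<Rightarrow> 'a) \<Rightarrow> nat" where
  "map_degree \<omega> f = (THE k. \<forall>y. (\<Sum>x\<in>f -` {y}. local_degree \<omega> f x) = k)"

definition crit :: "('a::topological_space) chain set \<Rightarrow> ('a \<Rightarrow> 'a) \<Rightarrow> 'a set" where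
  "crit \<omega> f = {x. local_degree \<omega> f x \<ge> 2}"

definition post :: "('a::topological_space) chain set \<Rightarrow> ('a \<Rightarrow> 'a) \<Rightarrow> 'a set" where
  "post \<omega> f = {(f ^^ n) x | n x. x \<in> crit \<omega> f \<and> n \<ge> 1}"

definition Thurston_map :: "('a::topological_space) chain set \<Rightarrow> ('a \<Rightarrow> 'a) \<Rightarrow> bool" where
  "Thurston_map \<omega> f \<longleftrightarrow>
     branched_covering \<omega> f \<and> map_degree \<omega> f \<ge> 2 \<and> finite (post \<omega> f)"

definition Jordan_curve :: "('a::topological_space) set \<Rightarrow> bool" where
  "Jordan_curve C \<longleftrightarrow>
     (\<exists>\<gamma>. simple_path \<gamma> \<and> pathfinish \<gamma> = pathstart \<gamma> \<and> path_image \<gamma> = C)"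

definition tiles :: "(('a::topological_space) \<Rightarrow> 'a) \<Rightarrow> 'a set \<Rightarrow> nat \<Rightarrow> 'a set set" where
  "tiles f C n = closure ` components (UNIV - (f ^^ n) -` C)"

definition diameter_wrt :: "('a \<Rightarrow> 'a \<Rightarrow> real) \<Rightarrow> 'a set \<Rightarrow> real" where
  "diameter_wrt d T = (SUP (x, y)\<in>T \<times> T. d x y)"

definition expanding_Thurston_map :: "('a::topological_space) chain set \<Rightarrow> ('a \<Rightarrow> 'a) \<Rightarrow> bool" where
  "expanding_Thurston_map \<omega> f \<longleftrightarrow> Thurston_map \<omega> f \<and>
     (\<exists>d C. Metric_space UNIV d \<and> Metric_space.mtopology UNIV d = euclidean \<and>
            Jordan_curve C \<and> post \<omega> f \<subseteq> C \<and>
            (\<lambda>n. SUP T\<in>tiles f C n. diameter_wrt d T) \<longlonglongrightarrow> 0)"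

definition periodic_critical_points ::
  "('a::topological_space) chain set \<Rightarrow> ('a \<Rightarrow> 'a) \<Rightarrow> 'a set" where
  "periodic_critical_points \<omega> f = {x \<in> crit \<omega> f. \<exists>n\<ge>1. (f ^^ n) x = x}"

section \<open>Measure-theoretic entropy\<close>

definition finite_measurable_partition :: "'a measure \<Rightarrow> 'a set set \<Rightarrow> bool" where
  "finite_measurable_partition \<mu> \<xi> \<longleftrightarrow>
     finite \<xi> \<and> \<xi> \<subseteq> sets \<mu> \<and> partition_on (space \<mu>) \<xi>"

text \<open>The convention \<open>0 log 0 = 0\<close> holds because \<open>ln 0 = 0\<close>.\<close>

definition partition_entropy :: "'a measure \<Rightarrow> 'a set set \<Rightarrow> real" where
  "partition_entropy \<mu> \<xi> = - (\<Sum>A\<in>\<xi>. measure \<mu> A * ln (measure \<mu> A))"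

text \<open>The join of the pulled back partitions \<open>f\<^sup>-\<^sup>i \<xi>\<close> for \<open>0 \<le> i < n\<close>.\<close>

definition iterated_join :: "'a measure \<Rightarrow> ('a \<Rightarrow> 'a) \<Rightarrow> 'a set set \<Rightarrow> nat \<Rightarrow> 'a set set" where
  "iterated_join \<mu> f \<xi> n =
     common_refinement ((\<lambda>i. (\<lambda>A. (f ^^ i) -` A \<inter> space \<mu>) ` \<xi> - {{}}) ` {..<n})"

text \<open>The limit exists, by subadditivity, whenever \<open>\<mu>\<close> is \<open>f\<close>-invariant.\<close>

definition partition_entropy_rate :: "'a measure \<Rightarrow> ('a \<Rightarrow> 'a) \<Rightarrow> 'a set set \<Rightarrow> real" where
  "partition_entropy_rate \<mu> f \<xi> =
     lim (\<lambda>n. partition_entropy \<mu> (iterated_join \<mu> f \<xi> n) / real n)"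

definition KS_entropy :: "'a measure \<Rightarrow> ('a \<Rightarrow> 'a) \<Rightarrow> ereal" where
  "KS_entropy \<mu> f =
     (SUP \<xi>\<in>{\<xi>. finite_measurable_partition \<mu> \<xi>}. ereal (partition_entropy_rate \<mu> f \<xi>))"

section \<open>Invariant measures and the weak* topology\<close>

definition borel_probability_measures :: "('a::topological_space) measure set" where
  "borel_probability_measures = {\<mu>. sets \<mu> = sets borel \<and> prob_space \<mu>}"

definition invariant_measures :: "('a::topological_space \<Rightarrow> 'a) \<Rightarrow> 'a measure set" where
  "invariant_measures f =
     {\<mu> \<in> borel_probability_measures. \<forall>A\<in>sets borel. emeasure \<mu> (f -` A) = emeasure \<mu> A}"

text \<open>
  The coarsest topology for which integration of every continuous real function is continuous
  (intended for compact spaces, where such functions are bounded).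
\<close>

definition weak_star_topology :: "('a::topological_space) measure topology" where
  "weak_star_topology = topology_generated_by
     {{\<mu> \<in> borel_probability_measures. (\<integral>x. g x \<partial>\<mu>) \<in> W} | (g :: 'a \<Rightarrow> real) W.
        continuous_on UNIV g \<and> open W}"

definition upper_semicontinuous :: "'b topology \<Rightarrow> ('b \<Rightarrow> ereal) \<Rightarrow> bool" where
  "upper_semicontinuous X h \<longleftrightarrow> (\<forall>x\<in>topspace X. Limsup (atin X x) h \<le> h x)"

end

theory Submission
  imports Defs "HOL-Complex_Analysis.Complex_Analysis" "HOL-Real_Asymp.Real_Asymp"
begin

text \<open>
  Entropy is upper semi-continuous because all entropy of \<open>f\<close> is seen, up to an arbitrarily small
  uniform error, by partitions of a fixed small size. Let \<open>\<xi>\<close> be a finite partition whose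
  elements have \<open>\<mu>\<close>-null frontier. For each fixed \<open>n\<close> the number
  \<open>H\<^sub>\<nu>(\<xi>\<^sub>n) / n\<close>, where \<open>\<xi>\<^sub>n\<close> is the join of the first \<open>n\<close> preimages of \<open>\<xi>\<close>, is then continuous
  in \<open>\<nu>\<close> at \<open>\<mu>\<close>, and by subadditivity it bounds \<open>h\<^sub>\<nu>(f, \<xi>)\<close> from above. So \<open>\<nu> \<mapsto> h\<^sub>\<nu>(f, \<xi>)\<close> is
  upper semi-continuous at \<open>\<mu>\<close>, and it remains to bound \<open>h\<^sub>\<nu>(f) - h\<^sub>\<nu>(f, \<xi>)\<close> by a small \<open>\<delta>\<close>
  for all invariant \<open>\<nu>\<close> simultaneously. Misiurewicz' condition of asymptotic h-expansiveness does
  this: for a suitable open cover \<open>\<U>\<close>, the points whose first \<open>n\<close> iterates follow a prescribed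
  sequence of members of \<open>\<U>\<close> split into at most \<open>C exp (\<delta> n)\<close> pieces that stay small under these
  iterates, however small the pieces are required to be (with \<open>C\<close> depending on that size).
  \<open>entropy_rate_le_of_conditional_entropy\<close> and \<open>KS_entropy_upper_semicontinuous\<close> carry this part,
  which holds for continuous maps of compact metrizable spaces.

  For an expanding Thurston map the pieces are tiles. Let a tile of level \<open>n + m\<close> be given, and look
  at its images under \<open>f\<^sup>i\<close> for \<open>i \<le> n\<close>: these are tiles of level at least \<open>m\<close>, hence small.
  Reading an orbit backwards, a tile of level \<open>k\<close> and the approximate position of a preimage
  determine the tile of level \<open>k + 1\<close> containing that preimage, unless the preimage is close to a
  critical point, where the number of choices is at most the local degree. If no critical point is
  periodic, then the times at which an orbit is close to a given critical point have gaps larger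
  than any prescribed \<open>N\<close>, once "close" is interpreted suitably. So the number of tiles following
  one word of length \<open>n\<close> grows at most like \<open>D ^ (p n / N)\<close>, where \<open>p\<close> is the number of critical
  points and \<open>D\<close> the largest local degree, and a large \<open>N\<close> makes the rate as small as desired. This
  is \<open>card_open_tiles_meeting_followers\<close> and \<open>asymptotically_h_expansive\<close>. The local
  normal form \<open>z \<mapsto> z\<^sup>d\<close> supplies what the count needs about \<open>f\<close>: it is open, its multiplicity near a
  point is at most the local degree, and its critical points are finite in number. The Jordan
  curve theorem in the plane shows that the curve defining the tiles is nowhere dense and has
  finitely many complementary components, so that finitely many tiles of each level cover the
  sphere.
\<close>

section \<open>Entropy of finite-valued observables\<close>

text \<open>
  A finite partition is represented by a function whose fibres are the elements of the partition.
  Joins then become pairs of functions, and the Shannon theory of simple random variables applies.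
\<close>

definition label_entropy :: "'a measure \<Rightarrow> ('a \<Rightarrow> 'b) \<Rightarrow> real" where
  "label_entropy M X =
     - (\<Sum>v\<in>X ` space M. measure M (X -` {v} \<inter> space M) * ln (measure M (X -` {v} \<inter> space M)))"

context prob_space
begin

lemma label_entropy_eq_entropy:
  assumes "simple_function M X"
  shows "label_entropy M X = entropy (exp 1) (count_space (X ` space M)) X"
proof -
  interpret information_space M "exp 1" by unfold_locales simp
  show ?thesis
    by (subst entropy_simple_distributed[OF simple_distributedI[OF assms measure_nonneg refl]])
       (simp add: label_entropy_def log_def)
qed

lemma label_entropy_Pair_le:
  assumes X: "simple_function M X" and Y: "simple_function M Y"
  shows "label_entropy M (\<lambda>x. (X x, Y x)) \<le> label_entropy M X + label_entropy M Y"
proof -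
  interpret information_space M "exp 1" by unfold_locales simp
  show ?thesis
    using entropy_chain_rule[OF X Y] conditional_entropy_less_eq_entropy[OF Y X]
    by (simp add: label_entropy_eq_entropy X Y simple_function_Pair)
qed

lemma label_entropy_le_of_factor:
  assumes X: "simple_function M X" and "\<And>x. x \<in> space M \<Longrightarrow> Y x = h (X x)"
  shows "label_entropy M Y \<le> label_entropy M X"
proof -
  interpret information_space M "exp 1" by unfold_locales simp
  have "label_entropy M Y = label_entropy M (h \<circ> X)"
  proof -
    have "Y -` {v} \<inter> space M = (h \<circ> X) -` {v} \<inter> space M" for v
      using assms(2) by auto
    moreover have "Y ` space M = (h \<circ> X) ` space M" using assms(2) by (auto simp: image_iff)
    ultimately show ?thesis unfolding label_entropy_def by simp
  qed
  also have "\<dots> \<le> label_entropy M X"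
    using entropy_data_processing[OF X, of h] X
    by (simp add: label_entropy_eq_entropy simple_function_compose)
  finally show ?thesis .
qed

lemma label_entropy_le_ln_card:
  assumes X: "simple_function M X"
  shows "label_entropy M X \<le> ln (card (X ` space M))"
proof -
  interpret information_space M "exp 1" by unfold_locales simp
  show ?thesis
    using entropy_le_card[OF simple_distributedI[OF X measure_nonneg refl]]
    by (simp add: label_entropy_eq_entropy X log_def)
qed

lemma label_entropy_nonneg: "label_entropy M X \<ge> 0"
proof -
  have "p * ln p \<le> 0" if "p = measure M (X -` {v} \<inter> space M)" for v p
  proof (cases "p = 0")
    case False
    then have "p > 0" "p \<le> 1" using that by (auto simp: measure_nonneg order.not_eq_order_implies_strict)
    then show ?thesis by (simp add: mult_nonneg_nonpos)
  qed simp
  then show ?thesis unfolding label_entropy_def by (simp add: sum_nonpos)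
qed

text \<open>
  If each value of \<open>Y\<close> leaves at most \<open>K\<close> possible values of \<open>X\<close>, then \<open>X\<close> is a function of \<open>Y\<close> and
  of the position of \<open>X\<close> in an enumeration of these possibilities, a variable with at most \<open>K\<close>
  values. This is how counting enters the entropy estimates.
\<close>

lemma label_entropy_le_of_multiplicity:
  assumes X: "simple_function M X" and Y: "simple_function M Y" and "K \<ge> 1"
    and K: "\<And>y. real (card (X ` (Y -` {y} \<inter> space M))) \<le> K"
  shows "label_entropy M X \<le> label_entropy M Y + ln K"
proof -
  define S where "S y = X ` (Y -` {y} \<inter> space M)" for y
  have finS: "finite (S y)" for y
    unfolding S_def by (rule finite_subset[OF _ simple_functionD(1)[OF X]]) auto
  have "\<exists>e. \<forall>y. inj_on (e y) (S y) \<and> e y ` S y = {..<card (S y)}"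
    by (intro choice allI) (metis bij_betw_def ex_bij_betw_finite_nat finS lessThan_atLeast0)
  then obtain e :: "'c \<Rightarrow> 'b \<Rightarrow> nat"
    where inj: "\<And>y. inj_on (e y) (S y)" and img: "\<And>y. e y ` S y = {..<card (S y)}"
    by blast
  define Z where "Z x = e (Y x) (X x)" for x
  have XS: "X x \<in> S (Y x)" if "x \<in> space M" for x using that by (auto simp: S_def)
  have XY: "simple_function M (\<lambda>x. (X x, Y x))" using X Y by (rule simple_function_Pair)
  have Z: "simple_function M Z"
    using simple_function_compose[OF XY, of "\<lambda>(x, y). e y x"] by (simp add: Z_def[abs_def] comp_def)
  have "label_entropy M X \<le> label_entropy M (\<lambda>x. (Y x, Z x))"
  proof (rule label_entropy_le_of_factor)
    show "simple_function M (\<lambda>x. (Y x, Z x))" using Y Z by (rule simple_function_Pair)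
    fix x assume "x \<in> space M"
    then show "X x = (\<lambda>(y, z). the_inv_into (S y) (e y) z) (Y x, Z x)"
      by (simp add: Z_def the_inv_into_f_f inj XS)
  qed
  also have "\<dots> \<le> label_entropy M Y + label_entropy M Z" using Y Z by (rule label_entropy_Pair_le)
  also have "label_entropy M Z \<le> ln K"
  proof -
    have "Z ` space M \<subseteq> {..<nat \<lfloor>K\<rfloor>}"
    proof
      fix z assume "z \<in> Z ` space M"
      then obtain x where x: "x \<in> space M" "z = e (Y x) (X x)" by (auto simp: Z_def)
      then have "z < card (S (Y x))" using img[of "Y x"] XS[of x] by (auto simp: set_eq_iff)
      then show "z \<in> {..<nat \<lfloor>K\<rfloor>}" using K[of "Y x"] unfolding S_def[symmetric] by (auto; linarith)
    qed
    then have "card (Z ` space M) \<le> nat \<lfloor>K\<rfloor>" using card_mono[of "{..<nat \<lfloor>K\<rfloor>}"] by force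
    then have le: "real (card (Z ` space M)) \<le> K" using \<open>K \<ge> 1\<close> by linarith
    have pos: "card (Z ` space M) > 0"
      using simple_functionD(1)[OF Z] not_empty by (auto simp: card_gt_0_iff)
    have "label_entropy M Z \<le> ln (card (Z ` space M))" by (rule label_entropy_le_ln_card[OF Z])
    also have "\<dots> \<le> ln K" using le pos by simp
    finally show ?thesis .
  qed
  finally show ?thesis by simp
qed

end

text \<open>
  Shannon entropy is a continuous function of a finite probability vector, including the vectors
  with vanishing entries, because \<open>x * ln x\<close> tends to \<open>0\<close> at \<open>0\<close>.
\<close>

lemma tendsto_sum_mult_ln:
  assumes "finite I" and m: "\<And>i. i \<in> I \<Longrightarrow> ((\<lambda>n. m n i) \<longlongrightarrow> c i) F"
    and nn: "\<And>n i. (m n i :: real) \<ge> 0"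
  shows "((\<lambda>n. - (\<Sum>i\<in>I. m n i * ln (m n i))) \<longlongrightarrow> - (\<Sum>i\<in>I. c i * ln (c i))) F"
proof (rule tendsto_minus, rule tendsto_sum)
  fix i assume i: "i \<in> I"
  show "((\<lambda>n. m n i * ln (m n i)) \<longlongrightarrow> c i * ln (c i)) F"
  proof (cases "c i = 0")
    case False
    then show ?thesis using m[OF i] by (auto intro!: tendsto_intros)
  next
    case True
    have "((\<lambda>x::real. x * ln x) \<longlongrightarrow> 0) (at_right 0)" by real_asymp
    then have "((\<lambda>x::real. x * ln x) \<longlongrightarrow> 0) (at 0 within {0..})"
      by (simp add: at_within_Ici_at_right)
    then have "((\<lambda>x::real. x * ln x) \<longlongrightarrow> 0 * ln 0) (inf (nhds 0) (principal {0..}))"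
      using tendsto_at_within_iff_tendsto_nhds[of "\<lambda>x::real. x * ln x" 0 "{0..}"] by simp
    moreover have "filterlim (\<lambda>n. m n i) (inf (nhds 0) (principal {0..})) F"
      using m[OF i] True by (simp add: filterlim_inf filterlim_principal nn)
    ultimately have "((\<lambda>n. m n i * ln (m n i)) \<longlongrightarrow> 0 * ln 0) F"
      by (rule filterlim_compose)
    then show ?thesis using True by simp
  qed
qed

section \<open>Entropy rates\<close>

text \<open>
  Writing \<open>n = k m + r\<close> with \<open>r < m\<close>, subadditivity gives \<open>a n \<le> k * a m + a r\<close>, and the second
  summand is bounded for fixed \<open>m\<close>. Thus every quotient \<open>a m / m\<close> eventually dominates \<open>a n / n\<close> up
  to a small error, and the sequence converges to its infimum.
\<close>

lemma Fekete:
  fixes a :: "nat \<Rightarrow> real"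
  assumes nn: "\<And>n. a n \<ge> 0" and sub: "\<And>m n. a (m + n) \<le> a m + a n"
  shows "\<exists>L. (\<lambda>n. a n / real n) \<longlonglongrightarrow> L \<and> (\<forall>n\<ge>1. L \<le> a n / real n)"
proof -
  define L where "L = (INF n\<in>{1..}. a n / real n)"
  have bdd: "bdd_below ((\<lambda>n. a n / real n) ` {1..})" by (auto intro!: bdd_belowI2[where m=0] simp: nn)
  have L: "L \<le> a n / real n" if "n \<ge> 1" for n
    unfolding L_def using that by (intro cINF_lower bdd) auto
  have mul: "a (k * m + r) \<le> real k * a m + a r" for k m r
  proof (induction k)
    case (Suc k)
    have "a (Suc k * m + r) \<le> a m + a (k * m + r)" using sub[of m "k * m + r"] by (simp add: add.assoc)
    then show ?case using Suc by (simp add: algebra_simps)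
  qed simp
  have "(\<lambda>n. a n / real n) \<longlonglongrightarrow> L"
  proof (rule LIMSEQ_I)
    fix e :: real assume "e > 0"
    have "\<exists>m\<in>{1..}. a m / real m < L + e / 2"
      unfolding L_def using \<open>e > 0\<close> bdd
      by (subst cINF_less_iff[symmetric]) (auto simp: L_def)
    then obtain m where m: "m \<ge> 1" "a m / real m < L + e / 2" by auto
    define B where "B = Max (a ` {..<m})"
    have B: "a r \<le> B" if "r < m" for r unfolding B_def using that by (intro Max_ge) auto
    have "(\<lambda>n. B / real n) \<longlonglongrightarrow> 0" by (rule lim_const_over_n)
    then have "\<forall>\<^sub>F n in sequentially. B / real n < e / 2" 
      by (rule order_tendstoD) (use \<open>e > 0\<close> in simp)
    then obtain n0 where n0: "\<And>n. n \<ge> n0 \<Longrightarrow> B / real n < e / 2" by (auto simp: eventually_sequentially)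
    have "norm (a n / real n - L) < e" if n: "n \<ge> max n0 1" for n
    proof -
      have "a n \<le> real (n div m) * a m + a (n mod m)" using mul[of "n div m" m "n mod m"] by simp
      also have "real (n div m) * a m \<le> (real n / real m) * a m"
      proof (rule mult_right_mono)
        have "real (n div m) * real m \<le> real n"
          by (metis div_times_less_eq_dividend of_nat_le_iff of_nat_mult)
        then show "real (n div m) \<le> real n / real m" using m by (simp add: pos_le_divide_eq)
      qed (rule nn)
      also have "a (n mod m) \<le> B" using m by (intro B) auto
      finally have "a n / real n \<le> (real n / real m * a m + B) / real n"
        using n by (intro divide_right_mono) auto
      also have "\<dots> = a m / real m + B / real n" using n m by (simp add: field_simps)
      also have "\<dots> < L + e" using m n0[of n] n by linarith
      finally show ?thesis using L[of n] n by auto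
    qed
    then show "\<exists>no. \<forall>n\<ge>no. norm (a n / real n - L) < e" by blast
  qed
  then show ?thesis using L by blast
qed

definition itinerary :: "('a \<Rightarrow> 'a) \<Rightarrow> ('a \<Rightarrow> 'b) \<Rightarrow> nat \<Rightarrow> 'a \<Rightarrow> 'b list" where
  "itinerary f \<alpha> n x = map (\<lambda>i. \<alpha> ((f ^^ i) x)) [0..<n]"

definition entropy_rate :: "'a measure \<Rightarrow> ('a \<Rightarrow> 'a) \<Rightarrow> ('a \<Rightarrow> 'b) \<Rightarrow> real" where
  "entropy_rate M f \<alpha> = lim (\<lambda>n. label_entropy M (itinerary f \<alpha> n) / real n)"

lemma itinerary_eq_iff:
  "itinerary f \<alpha> n x = itinerary f \<alpha> n y \<longleftrightarrow> (\<forall>i<n. \<alpha> ((f ^^ i) x) = \<alpha> ((f ^^ i) y))"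
  by (auto simp: itinerary_def list_eq_iff_nth_eq)

lemma nth_itinerary [simp]: "i < n \<Longrightarrow> itinerary f \<alpha> n x ! i = \<alpha> ((f ^^ i) x)"
  by (simp add: itinerary_def)

lemma length_itinerary [simp]: "length (itinerary f \<alpha> n x) = n"
  by (simp add: itinerary_def)

lemma itinerary_Pair:
  "itinerary f (\<lambda>x. (\<alpha> x, \<beta> x)) n x = zip (itinerary f \<alpha> n x) (itinerary f \<beta> n x)"
  by (rule nth_equalityI) auto

lemma itinerary_add: "itinerary f \<alpha> (m + n) x = itinerary f \<alpha> m x @ itinerary f \<alpha> n ((f ^^ m) x)"
proof (rule nth_equalityI)
  fix i assume i: "i < length (itinerary f \<alpha> (m + n) x)"
  have "(f ^^ i) x = (f ^^ (i - m)) ((f ^^ m) x)" if "m \<le> i"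
    using funpow_add[of "i - m" m f] that by simp
  then show "itinerary f \<alpha> (m + n) x ! i = (itinerary f \<alpha> m x @ itinerary f \<alpha> n ((f ^^ m) x)) ! i"
    using i by (simp add: nth_append)
qed simp

lemma continuous_on_funpow:
  fixes f :: "'a::topological_space \<Rightarrow> 'a"
  assumes "continuous_on UNIV f" shows "continuous_on UNIV (f ^^ n)"
proof (induction n)
  case (Suc n)
  then show ?case
    unfolding funpow.simps by (rule continuous_on_compose[OF _ continuous_on_subset[OF assms subset_UNIV]])
qed (simp add: id_def)

text \<open>
  The space is the whole type, so that preimages need no intersection with it.
\<close>

locale measure_preserving_system = prob_space +
  fixes f :: "'a \<Rightarrow> 'a"
  assumes space_UNIV [simp]: "space M = UNIV"
    and measurable_map: "f \<in> measurable M M"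
    and invariant: "\<And>A. A \<in> sets M \<Longrightarrow> measure M (f -` A) = measure M A"
begin

lemma measurable_funpow: "f ^^ n \<in> measurable M M"
proof (induction n)
  case (Suc n)
  then show ?case unfolding funpow.simps by (rule measurable_comp[OF _ measurable_map])
qed (simp add: id_def)

lemma invariant_funpow: "A \<in> sets M \<Longrightarrow> measure M ((f ^^ n) -` A) = measure M A"
proof (induction n)
  case (Suc n)
  have "(f ^^ n) -` A \<in> sets M" using measurable_sets[OF measurable_funpow Suc.prems] by simp
  moreover have "(f ^^ Suc n) -` A = f -` ((f ^^ n) -` A)" by (auto simp: funpow_swap1)
  ultimately show ?case using Suc invariant by (metis (no_types))
qed simp

lemma simple_function_iterate: "simple_function M \<alpha> \<Longrightarrow> simple_function M (\<lambda>x. \<alpha> ((f ^^ n) x))"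
  using simple_function_comp[OF measurable_funpow, of \<alpha> n] by simp

lemma simple_function_itinerary:
  assumes "simple_function M \<alpha>" shows "simple_function M (itinerary f \<alpha> n)"
proof (induction n)
  case 0
  then show ?case by (simp add: itinerary_def[abs_def])
next
  case (Suc n)
  have "simple_function M (\<lambda>x. (itinerary f \<alpha> n x, \<alpha> ((f ^^ n) x)))"
    by (intro simple_function_Pair Suc simple_function_iterate assms)
  from simple_function_compose[OF this, of "\<lambda>(l, a). l @ [a]"]
  show ?case by (simp add: itinerary_def[abs_def] comp_def)
qed

text \<open>
  Passing to \<open>X \<circ> f\<^sup>n\<close> can lose values of \<open>X\<close>, since \<open>f\<close> need not be onto, but only values
  attained on a null set.
\<close>

lemma label_entropy_iterate:
  assumes X: "simple_function M X"
  shows "label_entropy M (\<lambda>x. X ((f ^^ n) x)) = label_entropy M X"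
proof -
  have m: "measure M ((\<lambda>x. X ((f ^^ n) x)) -` {v}) = measure M (X -` {v})" for v
    using invariant_funpow[of "X -` {v}" n] simple_functionD(2)[OF X, of "{v}"]
    by (simp add: vimage_def)
  have "(\<Sum>v\<in>range (\<lambda>x. X ((f ^^ n) x)). measure M (X -` {v}) * ln (measure M (X -` {v})))
      = (\<Sum>v\<in>range X. measure M (X -` {v}) * ln (measure M (X -` {v})))"
  proof (rule sum.mono_neutral_left)
    show "finite (range X)" using simple_functionD(1)[OF X] by simp
    have "measure M (X -` {v}) = 0" if "v \<notin> range (\<lambda>x. X ((f ^^ n) x))" for v
    proof -
      have "(\<lambda>x. X ((f ^^ n) x)) -` {v} = {}" using that by auto
      then show ?thesis using m[of v] by simp
    qed
    then show "\<forall>v\<in>range X - range (\<lambda>x. X ((f ^^ n) x)).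
        measure M (X -` {v}) * ln (measure M (X -` {v})) = 0" by auto
  qed auto
  then show ?thesis by (simp add: label_entropy_def m)
qed

lemma label_entropy_itinerary_add:
  assumes "simple_function M \<alpha>"
  shows "label_entropy M (itinerary f \<alpha> (m + n))
    \<le> label_entropy M (itinerary f \<alpha> m) + label_entropy M (itinerary f \<alpha> n)"
proof -
  note S = simple_function_itinerary[OF assms]
  have S': "simple_function M (\<lambda>x. itinerary f \<alpha> n ((f ^^ m) x))"
    by (rule simple_function_iterate[OF S])
  have "label_entropy M (itinerary f \<alpha> (m + n))
      \<le> label_entropy M (\<lambda>x. (itinerary f \<alpha> m x, itinerary f \<alpha> n ((f ^^ m) x)))"
    by (rule label_entropy_le_of_factor[where h = "\<lambda>(l, l'). l @ l'"])
       (simp_all add: simple_function_Pair S S' itinerary_add)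
  also have "\<dots> \<le> label_entropy M (itinerary f \<alpha> m) + label_entropy M (itinerary f \<alpha> n)"
    using label_entropy_Pair_le[OF S S', of m] by (simp add: label_entropy_iterate S)
  finally show ?thesis .
qed

lemma
  assumes "simple_function M \<alpha>"
  shows entropy_rate_tendsto:
      "(\<lambda>n. label_entropy M (itinerary f \<alpha> n) / real n) \<longlonglongrightarrow> entropy_rate M f \<alpha>"
    and entropy_rate_le: "n \<ge> 1 \<Longrightarrow> entropy_rate M f \<alpha> \<le> label_entropy M (itinerary f \<alpha> n) / real n"
proof -
  obtain L where L: "(\<lambda>n. label_entropy M (itinerary f \<alpha> n) / real n) \<longlonglongrightarrow> L"
      "\<forall>n\<ge>1. L \<le> label_entropy M (itinerary f \<alpha> n) / real n"
    using Fekete[of "\<lambda>n. label_entropy M (itinerary f \<alpha> n)"]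
      label_entropy_nonneg label_entropy_itinerary_add[OF assms] by blast
  then have "entropy_rate M f \<alpha> = L" unfolding entropy_rate_def by (simp add: limI)
  with L show "(\<lambda>n. label_entropy M (itinerary f \<alpha> n) / real n) \<longlonglongrightarrow> entropy_rate M f \<alpha>"
    "n \<ge> 1 \<Longrightarrow> entropy_rate M f \<alpha> \<le> label_entropy M (itinerary f \<alpha> n) / real n" by auto
qed

lemma label_entropy_itinerary_le:
  assumes "simple_function M \<alpha>"
  shows "label_entropy M (itinerary f \<alpha> n) \<le> real n * label_entropy M \<alpha>"
proof (induction n)
  case 0
  have "prob UNIV = 1" using prob_space by simp
  then show ?case by (simp add: label_entropy_def itinerary_def[abs_def])
next
  case (Suc n)
  have "label_entropy M (itinerary f \<alpha> 1) \<le> label_entropy M \<alpha>"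
    by (rule label_entropy_le_of_factor[where h = "\<lambda>a. [a]"]) (simp_all add: assms itinerary_def)
  with label_entropy_itinerary_add[OF assms, of 1 n] Suc show ?case by (simp add: algebra_simps)
qed

end

definition fibres :: "('a \<Rightarrow> 'b) \<Rightarrow> 'a set set" where
  "fibres X = range (\<lambda>x. X -` {X x})"

lemma partition_entropy_fibres:
  assumes "space M = UNIV" shows "partition_entropy M (fibres X) = label_entropy M X"
proof -
  have "fibres X = (\<lambda>v. X -` {v}) ` range X" by (auto simp: fibres_def)
  moreover have "inj_on (\<lambda>v. X -` {v}) (range X)" by (auto simp: inj_on_def)
  ultimately show ?thesis
    by (simp add: partition_entropy_def label_entropy_def sum.reindex assms)
qed

text \<open>
  The partitions pulled back by different iterates may coincide as sets of sets, so the common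
  refinement is indexed by fewer objects than the itinerary. A choice function therefore has to
  depend on the partition alone: it picks the element containing a given point.
\<close>

lemma common_refinement_fibres:
  "common_refinement ((\<lambda>i. fibres (\<lambda>x. X ((f ^^ i) x))) ` {..<n}) = fibres (itinerary f X n)"
proof -
  let ?P = "\<lambda>i. fibres (\<lambda>x. X ((f ^^ i) x))"
  let ?c = "\<lambda>i y. {z. X ((f ^^ i) z) = X ((f ^^ i) y)}"
  have it: "itinerary f X n -` {itinerary f X n y} = (\<Inter>i<n. ?c i y)" for y
    by (auto simp: itinerary_eq_iff)
  have uniq: "A = ?c i y" if "A \<in> ?P i" "y \<in> A" for A i y
    using that by (auto simp: fibres_def)
  have mem: "?c i y \<in> ?P i" for i y by (auto simp: fibres_def)
  show ?thesis
  proof (intro equalityI subsetI)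
    fix A assume "A \<in> common_refinement (?P ` {..<n})"
    then obtain h y where h: "\<And>i. i < n \<Longrightarrow> h (?P i) \<in> ?P i" and A: "A = \<Inter> (h ` ?P ` {..<n})" "y \<in> A"
      unfolding common_refinement by fastforce
    have "h (?P i) = ?c i y" if "i < n" for i using h[OF that] A that by (intro uniq) auto
    then have "A = (\<Inter>i<n. ?c i y)" using A by auto
    then show "A \<in> fibres (itinerary f X n)" unfolding fibres_def it[symmetric] by auto
  next
    fix A assume "A \<in> fibres (itinerary f X n)"
    then obtain y where A: "A = (\<Inter>i<n. ?c i y)" unfolding fibres_def it[symmetric] by auto
    define h where "h P = \<Union> {B \<in> P. y \<in> B}" for P
    have h: "h (?P i) = ?c i y" for i
    proof -
      have "{B \<in> ?P i. y \<in> B} = {?c i y}" using uniq[of _ i y] mem[of i y] by blast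
      then show ?thesis by (simp add: h_def)
    qed
    have "A = \<Inter> (h ` ?P ` {..<n})" using A h by auto
    moreover have "h \<in> (\<Pi> P\<in>?P ` {..<n}. P)" using h mem by auto
    moreover have "y \<in> A" using A by auto
    ultimately show "A \<in> common_refinement (?P ` {..<n})" unfolding common_refinement by blast
  qed
qed

lemma iterated_join_fibres:
  assumes "space M = UNIV"
  shows "iterated_join M f (fibres X) n = fibres (itinerary f X n)"
proof -
  have "(\<lambda>A. (f ^^ i) -` A \<inter> space M) ` fibres X - {{}} = fibres (\<lambda>x. X ((f ^^ i) x))" for i
  proof (intro equalityI subsetI)
    fix A assume "A \<in> (\<lambda>A. (f ^^ i) -` A \<inter> space M) ` fibres X - {{}}"
    then obtain x y where "A = (f ^^ i) -` (X -` {X x})" "y \<in> A" using assms by (auto simp: fibres_def)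
    then have "A = (\<lambda>x. X ((f ^^ i) x)) -` {X ((f ^^ i) y)}" by auto
    then show "A \<in> fibres (\<lambda>x. X ((f ^^ i) x))" by (auto simp: fibres_def)
  next
    fix A assume "A \<in> fibres (\<lambda>x. X ((f ^^ i) x))"
    then obtain y where "A = (f ^^ i) -` (X -` {X ((f ^^ i) y)})" by (auto simp: fibres_def)
    then show "A \<in> (\<lambda>A. (f ^^ i) -` A \<inter> space M) ` fibres X - {{}}"
      using assms by (auto simp: fibres_def)
  qed
  then show ?thesis by (simp add: iterated_join_def common_refinement_fibres)
qed

lemma partition_entropy_rate_fibres:
  "space M = UNIV \<Longrightarrow> partition_entropy_rate M f (fibres X) = entropy_rate M f X"
  by (simp add: partition_entropy_rate_def entropy_rate_def iterated_join_fibres partition_entropy_fibres)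

lemma entropy_rate_le_KS_entropy:
  assumes "space M = UNIV" "simple_function M X"
  shows "ereal (entropy_rate M f X) \<le> KS_entropy M f"
proof -
  have "finite_measurable_partition M (fibres X)"
    unfolding finite_measurable_partition_def
  proof (intro conjI)
    have eq: "fibres X = (\<lambda>v. X -` {v}) ` range X" by (auto simp: fibres_def)
    show "finite (fibres X)" unfolding eq using simple_functionD(1)[OF assms(2)] assms(1) by simp
    show "fibres X \<subseteq> sets M"
      unfolding eq using simple_functionD(2)[OF assms(2)] assms(1) by auto
    show "partition_on (space M) (fibres X)"
      by (auto simp: partition_on_def fibres_def disjoint_def assms)
  qed
  then show ?thesis
    unfolding KS_entropy_def
    by (intro SUP_upper2[of "fibres X"]) (simp_all add: partition_entropy_rate_fibres assms)
qed

text \<open>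
  A finite measurable partition is the set of fibres of the function that sends a point to the
  element containing it. Labels of type \<open>'a set\<close> are therefore general enough.
\<close>

lemma KS_entropy_le:
  fixes M :: "'a measure"
  assumes M: "space M = UNIV"
    and le: "\<And>X :: 'a \<Rightarrow> 'a set. simple_function M X \<Longrightarrow> ereal (entropy_rate M f X) \<le> c"
  shows "KS_entropy M f \<le> c"
  unfolding KS_entropy_def
proof (rule SUP_least)
  fix \<xi> assume "\<xi> \<in> {\<xi>. finite_measurable_partition M \<xi>}"
  then have fin: "finite \<xi>" and sets: "\<xi> \<subseteq> sets M" and part: "partition_on UNIV \<xi>"
    using M by (auto simp: finite_measurable_partition_def)
  define X where "X x = \<Union> {A \<in> \<xi>. x \<in> A}" for x
  have X: "X x = A" if "A \<in> \<xi>" "x \<in> A" for x A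
  proof -
    have "{A \<in> \<xi>. x \<in> A} = {A}"
      using that part unfolding partition_on_def disjoint_def by blast
    then show ?thesis by (simp add: X_def)
  qed
  have ex: "\<exists>A\<in>\<xi>. x \<in> A" for x using part by (auto simp: partition_on_def)
  have vim: "X -` {A} = A" if "A \<in> \<xi>" for A using X ex that by (auto, metis)
  have rng: "range X = \<xi>"
    using X ex part by (auto simp: partition_on_def image_iff) (metis, metis ex_in_conv)
  have "simple_function M X"
    unfolding simple_function_def using rng fin sets vim M by auto
  moreover have "fibres X = \<xi>"
  proof -
    have "fibres X = (\<lambda>v. X -` {v}) ` range X" by (auto simp: fibres_def)
    then show ?thesis using rng vim by auto
  qed
  ultimately show "ereal (partition_entropy_rate M f \<xi>) \<le> c"
    using le partition_entropy_rate_fibres[OF M, of f X] by simp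
qed

section \<open>Invariant measures and the weak* topology\<close>

lemma invariant_measures_measure_preserving:
  assumes "\<mu> \<in> invariant_measures f" "continuous_on UNIV f"
  shows "measure_preserving_system \<mu> f"
proof -
  have s: "sets \<mu> = sets borel" and p: "prob_space \<mu>"
    and i: "\<And>A. A \<in> sets borel \<Longrightarrow> emeasure \<mu> (f -` A) = emeasure \<mu> A"
    using assms by (auto simp: invariant_measures_def borel_probability_measures_def)
  interpret prob_space \<mu> by fact
  show ?thesis
  proof
    show "space \<mu> = UNIV" using sets_eq_imp_space_eq[OF s] by simp
    show "f \<in> measurable \<mu> \<mu>"
      using borel_measurable_continuous_onI[OF assms(2)] measurable_cong_sets[OF s s] by simp
    show "measure \<mu> (f -` A) = measure \<mu> A" if "A \<in> sets \<mu>" for A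
      using i that s by (simp add: measure_def)
  qed
qed

text \<open>
  Perfect normality, in a form from which four things are derived below: it gives functions
  approximating the indicator of a closed set, neighbourhoods of a point with null frontier, and
  inner regularity of Borel measures. It also allows neighbourhoods to be shrunk.
\<close>

definition closed_sets_are_zero_sets :: "'a::topological_space itself \<Rightarrow> bool" where
  "closed_sets_are_zero_sets _ \<longleftrightarrow>
     (\<forall>F :: 'a set. closed F \<longrightarrow> (\<exists>\<phi> :: 'a \<Rightarrow> real. continuous_on UNIV \<phi> \<and> (\<forall>x. 0 \<le> \<phi> x) \<and> F = {x. \<phi> x = 0}))"

abbreviation at_invariant :: "('a::topological_space \<Rightarrow> 'a) \<Rightarrow> 'a measure \<Rightarrow> 'a measure filter" where
  "at_invariant f \<mu> \<equiv> atin (subtopology weak_star_topology (invariant_measures f)) \<mu>"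

lemma eventually_invariant: "\<forall>\<^sub>F \<nu> in at_invariant f \<mu>. \<nu> \<in> invariant_measures f"
  unfolding eventually_atin
  using openin_topspace[of "subtopology weak_star_topology (invariant_measures f)"] by auto

lemma eventually_integral_weak_star:
  fixes g :: "'a::topological_space \<Rightarrow> real"
  assumes "\<mu> \<in> invariant_measures f" "continuous_on UNIV g" "open W" "(\<integral>x. g x \<partial>\<mu>) \<in> W"
  shows "\<forall>\<^sub>F \<nu> in at_invariant f \<mu>. (\<integral>x. g x \<partial>\<nu>) \<in> W"
proof -
  let ?U = "{\<nu> \<in> borel_probability_measures. (\<integral>x. g x \<partial>\<nu>) \<in> W}"
  have "openin weak_star_topology ?U"
    unfolding weak_star_topology_def openin_topology_generated_by_iff
    by (rule generate_topology_on.Basis) (use assms in blast)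
  then have "openin (subtopology weak_star_topology (invariant_measures f)) (?U \<inter> invariant_measures f)"
    by (auto simp: openin_subtopology)
  then show ?thesis
    unfolding eventually_atin using assms by (auto simp: invariant_measures_def)
qed

text \<open>
  The functions \<open>max 0 (1 - k \<phi>)\<close>, with \<open>\<phi>\<close> vanishing exactly on \<open>F\<close>, decrease to the indicator of
  \<open>F\<close>; the integral of one of them is already below \<open>a\<close>, which is a weak* open condition.
\<close>

lemma eventually_measure_closed_less:
  fixes F :: "'a::topological_space set"
  assumes zero: "closed_sets_are_zero_sets TYPE('a)"
    and \<mu>: "\<mu> \<in> invariant_measures f" and F: "closed F" and a: "measure \<mu> F < a"
  shows "\<forall>\<^sub>F \<nu> in at_invariant f \<mu>. measure \<nu> F < a"
proof -
  obtain \<phi> :: "'a \<Rightarrow> real" where \<phi>: "continuous_on UNIV \<phi>" "\<And>x. 0 \<le> \<phi> x" "F = {x. \<phi> x = 0}"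
    using zero F unfolding closed_sets_are_zero_sets_def by blast
  define g where "g k x = max 0 (1 - real k * \<phi> x)" for k x
  have gc: "continuous_on UNIV (g k)" for k
    unfolding g_def[abs_def] by (intro continuous_intros \<phi>)
  have g01: "0 \<le> g k x" "g k x \<le> 1" for k x unfolding g_def using \<phi>(2)[of x] by auto
  have gF: "g k x = 1" if "x \<in> F" for k x using that \<phi> by (simp add: g_def)
  have gint: "integrable \<nu> (g k)" if "\<nu> \<in> invariant_measures f" for \<nu> k
  proof -
    have s: "sets \<nu> = sets borel" and "prob_space \<nu>"
      using that by (auto simp: invariant_measures_def borel_probability_measures_def)
    interpret prob_space \<nu> by fact
    have "g k \<in> borel_measurable \<nu>"
      using borel_measurable_continuous_onI[OF gc] measurable_cong_sets[OF s refl] by blast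
    then show ?thesis using g01 by (intro integrable_const_bound[where B = 1]) (auto simp: abs_le_iff)
  qed
  have le: "measure \<nu> F \<le> (\<integral>x. g k x \<partial>\<nu>)" if \<nu>: "\<nu> \<in> invariant_measures f" for \<nu> k
  proof -
    have s: "sets \<nu> = sets borel" and "prob_space \<nu>"
      using that by (auto simp: invariant_measures_def borel_probability_measures_def)
    interpret prob_space \<nu> by fact
    have "F \<in> sets \<nu>" using F s by simp
    moreover have "space \<nu> = UNIV" using sets_eq_imp_space_eq[OF s] by simp
    ultimately have "measure \<nu> F = (\<integral>x. indicator F x \<partial>\<nu>)" by simp
    also have "\<dots> \<le> (\<integral>x. g k x \<partial>\<nu>)"
      using \<open>F \<in> sets \<nu>\<close>
      by (intro integral_mono gint[OF \<nu>] integrable_real_indicator)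
         (auto simp: indicator_def gF g01 less_top[symmetric])
    finally show ?thesis .
  qed
  have lim: "(\<lambda>k. \<integral>x. g k x \<partial>\<mu>) \<longlonglongrightarrow> (\<integral>x. indicator F x \<partial>\<mu>)"
  proof (rule integral_dominated_convergence[where w = "\<lambda>_. 1"])
    have s: "sets \<mu> = sets borel" and "prob_space \<mu>"
      using \<mu> by (auto simp: invariant_measures_def borel_probability_measures_def)
    interpret prob_space \<mu> by fact
    show "integrable \<mu> (\<lambda>_. 1 :: real)" by simp
    show "(indicator F :: 'a \<Rightarrow> real) \<in> borel_measurable \<mu>" using F s by (intro borel_measurable_indicator) simp
    show "g k \<in> borel_measurable \<mu>" for k using gint[OF \<mu>] by auto
    have "(\<lambda>k. g k x) \<longlonglongrightarrow> indicator F x" for x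
    proof (cases "x \<in> F")
      case True then show ?thesis by (simp add: gF)
    next
      case False
      then have pos: "\<phi> x > 0" using \<phi>(2)[of x] \<phi>(3) by (simp add: order.not_eq_order_implies_strict)
      have "\<forall>\<^sub>F k in sequentially. real k \<ge> 1 / \<phi> x"
        by real_asymp
      then have "\<forall>\<^sub>F k in sequentially. g k x = 0"
        by eventually_elim (use pos in \<open>auto simp: g_def field_simps\<close>)
      then show ?thesis using False by (simp add: tendsto_eventually)
    qed
    then show "AE x in \<mu>. (\<lambda>k. g k x) \<longlonglongrightarrow> indicator F x" by simp
    show "AE x in \<mu>. norm (g k x) \<le> 1" for k using g01 by (simp add: abs_le_iff)
  qed
  moreover have "(\<integral>x. indicator F x \<partial>\<mu>) = measure \<mu> F"
  proof -
    have "sets \<mu> = sets borel" using \<mu> by (auto simp: invariant_measures_def borel_probability_measures_def)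
    then show ?thesis using sets_eq_imp_space_eq[of \<mu> borel] by simp
  qed
  ultimately obtain k where "(\<integral>x. g k x \<partial>\<mu>) < a"
    using order_tendstoD(2)[of _ "measure \<mu> F" sequentially a] a by (auto simp: eventually_sequentially)
  then have "\<forall>\<^sub>F \<nu> in at_invariant f \<mu>.
      (\<integral>x. g k x \<partial>\<nu>) \<in> {..<a}"
    by (intro eventually_integral_weak_star[OF \<mu> gc]) auto
  moreover have "\<forall>\<^sub>F \<nu> in at_invariant f \<mu>.
      \<nu> \<in> invariant_measures f"
    by (rule eventually_invariant)
  ultimately show ?thesis
  proof eventually_elim
    case (elim \<nu>)
    then show ?case using le[of \<nu> k] by simp
  qed
qed

text \<open>
  The bound for closed sets applies to the closures of \<open>D\<close> and of its complement, which have the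
  same \<open>\<mu>\<close>-measure as \<open>D\<close> and its complement.
\<close>

lemma tendsto_measure_of_null_frontier:
  fixes D :: "'a::topological_space set"
  assumes zero: "closed_sets_are_zero_sets TYPE('a)"
    and \<mu>: "\<mu> \<in> invariant_measures f" and D: "D \<in> sets borel" and fr: "measure \<mu> (frontier D) = 0"
  shows "((\<lambda>\<nu>. measure \<nu> D) \<longlongrightarrow> measure \<mu> D)
           (at_invariant f \<mu>)"
proof -
  have up: "\<forall>\<^sub>F \<nu> in at_invariant f \<mu>. measure \<nu> E < a"
    if E: "E \<in> sets borel" "measure \<mu> (frontier E) = 0" and a: "measure \<mu> E < a" for E a
  proof -
    have s: "sets \<mu> = sets borel" and "prob_space \<mu>"
      using \<mu> by (auto simp: invariant_measures_def borel_probability_measures_def)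
    interpret prob_space \<mu> by fact
    have "measure \<mu> (closure E) \<le> measure \<mu> (E \<union> frontier E)"
      using E s by (intro finite_measure_mono) (auto simp: closure_Un_frontier)
    also have "\<dots> \<le> measure \<mu> E + measure \<mu> (frontier E)"
      using E s by (intro measure_Un_le) auto
    finally have "measure \<mu> (closure E) < a" using E a by simp
    then have "\<forall>\<^sub>F \<nu> in at_invariant f \<mu>. measure \<nu> (closure E) < a"
      by (intro eventually_measure_closed_less[OF zero \<mu>]) auto
    moreover have "\<forall>\<^sub>F \<nu> in at_invariant f \<mu>. \<nu> \<in> invariant_measures f"
      by (rule eventually_invariant)
    ultimately show ?thesis
    proof eventually_elim
      case (elim \<nu>)
      then have s: "sets \<nu> = sets borel" and "prob_space \<nu>"
        by (auto simp: invariant_measures_def borel_probability_measures_def)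
      interpret \<nu>: prob_space \<nu> by fact
      have "measure \<nu> E \<le> measure \<nu> (closure E)"
        using s closure_subset by (intro \<nu>.finite_measure_mono) auto
      then show ?case using elim by simp
    qed
  qed
  have compl: "measure \<nu> (- D) = 1 - measure \<nu> D" if "\<nu> \<in> invariant_measures f" for \<nu>
  proof -
    have s: "sets \<nu> = sets borel" and "prob_space \<nu>"
      using that by (auto simp: invariant_measures_def borel_probability_measures_def)
    interpret \<nu>: prob_space \<nu> by fact
    have "space \<nu> = UNIV" using sets_eq_imp_space_eq[OF s] by simp
    then show ?thesis using \<nu>.prob_compl[of D] D s by (simp add: Compl_eq_Diff_UNIV)
  qed
  show ?thesis
  proof (rule order_tendstoI)
    fix a assume "measure \<mu> D < a"
    then show "\<forall>\<^sub>F \<nu> in at_invariant f \<mu>. measure \<nu> D < a" using up[OF D fr] by simp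
  next
    fix a assume "a < measure \<mu> D"
    then have "\<forall>\<^sub>F \<nu> in at_invariant f \<mu>. measure \<nu> (- D) < 1 - a"
      using D fr by (intro up) (auto simp: compl[OF \<mu>] frontier_complement)
    moreover have "\<forall>\<^sub>F \<nu> in at_invariant f \<mu>. \<nu> \<in> invariant_measures f"
      by (rule eventually_invariant)
    ultimately show "\<forall>\<^sub>F \<nu> in at_invariant f \<mu>. a < measure \<nu> D"
      by eventually_elim (simp add: compl)
  qed
qed

section \<open>Upper semi-continuity from asymptotic h-expansiveness\<close>

definition finite_open_cover :: "'a::topological_space set set \<Rightarrow> bool" where
  "finite_open_cover \<U> \<longleftrightarrow> finite \<U> \<and> (\<forall>U\<in>\<U>. open U) \<and> \<Union>\<U> = UNIV"

text \<open>
  A bound for Misiurewicz' topological conditional entropy of \<open>f\<close> with respect to \<open>\<U>\<close>. The constant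
  may depend on the fineness \<open>\<V>\<close> of the pieces, but neither on \<open>n\<close> nor on the word \<open>s\<close>; the rate \<open>\<delta>\<close> is
  the same for all \<open>\<V>\<close>.
\<close>

definition conditional_entropy_at_most ::
    "('a::topological_space \<Rightarrow> 'a) \<Rightarrow> 'a set set \<Rightarrow> real \<Rightarrow> bool" where
  "conditional_entropy_at_most f \<U> \<delta> \<longleftrightarrow>
     (\<forall>\<V>. finite_open_cover \<V> \<longrightarrow> (\<exists>C. \<forall>n s. (\<forall>i<n. s i \<in> \<U>) \<longrightarrow>
        (\<exists>\<E>. finite \<E> \<and> real (card \<E>) \<le> C * exp (\<delta> * real n) \<and>
             {y. \<forall>i<n. (f ^^ i) y \<in> s i} \<subseteq> \<Union>\<E> \<and> (\<forall>E\<in>\<E>. \<forall>i<n. \<exists>V\<in>\<V>. (f ^^ i) ` E \<subseteq> V))))"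

definition asymptotically_h_expansive :: "('a::topological_space \<Rightarrow> 'a) \<Rightarrow> bool" where
  "asymptotically_h_expansive f \<longleftrightarrow>
     (\<forall>\<delta>>0. \<exists>\<U>. finite_open_cover \<U> \<and> conditional_entropy_at_most f \<U> \<delta>)"

text \<open>
  Open sets are exhausted by the closed sets \<open>{1 / (n + 1) \<le> \<phi>}\<close>. The sets that can be squeezed
  between a closed and an open set of almost the same measure form a sigma-algebra.
\<close>

lemma closed_inner_regular:
  fixes M :: "'a::topological_space measure"
  assumes zero: "closed_sets_are_zero_sets TYPE('a)" and M: "sets M = sets borel" "finite_measure M"
    and B: "B \<in> sets borel" and e: "e > (0::real)"
  shows "\<exists>K\<subseteq>B. closed K \<and> measure M (B - K) < e"
proof -
  interpret finite_measure M by fact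
  have op: "\<exists>K\<subseteq>B. closed K \<and> measure M (B - K) < e" if "open B" "e > 0" for B and e :: real
  proof -
    obtain \<phi> :: "'a \<Rightarrow> real" where \<phi>: "continuous_on UNIV \<phi>" "\<And>x. 0 \<le> \<phi> x" "- B = {x. \<phi> x = 0}"
      using zero \<open>open B\<close> unfolding closed_sets_are_zero_sets_def closed_def
      by (metis double_complement)
    have pos: "\<phi> x > 0" if "x \<in> B" for x using \<phi>(2)[of x] \<phi>(3) that by force
    define K where "K n = {x. 1 / real (Suc n) \<le> \<phi> x}" for n
    have cl: "closed (K n)" for n unfolding K_def by (intro closed_Collect_le \<phi> continuous_intros)
    have KB: "K n \<subseteq> B" for n
    proof
      fix x assume "x \<in> K n"
      moreover have "1 / real (Suc n) > 0" by simp
      ultimately have "\<phi> x \<noteq> 0" unfolding K_def by auto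
      then show "x \<in> B" using \<phi>(3) by auto
    qed
    have "(\<lambda>n. measure M (B - K n)) \<longlonglongrightarrow> measure M (\<Inter>n. B - K n)"
    proof (rule finite_Lim_measure_decseq)
      show "range (\<lambda>n. B - K n) \<subseteq> sets M" using cl \<open>open B\<close> M by auto
      have "K m \<subseteq> K n" if "m \<le> n" for m n
      proof -
        have "1 / real (Suc n) \<le> 1 / real (Suc m)" using that by (intro divide_left_mono) auto
        then show ?thesis unfolding K_def by auto
      qed
      then show "decseq (\<lambda>n. B - K n)" by (auto simp: decseq_def)
    qed
    moreover have "(\<Inter>n. B - K n) = {}"
    proof -
      have "\<exists>n. x \<in> K n" if "x \<in> B" for x
        using reals_Archimedean[OF pos[OF that]] by (auto simp: K_def inverse_eq_divide intro: less_imp_le)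
      then show ?thesis by blast
    qed
    ultimately have "(\<lambda>n. measure M (B - K n)) \<longlonglongrightarrow> 0" by (simp only: measure_empty)
    then have "\<forall>\<^sub>F n in sequentially. measure M (B - K n) < e" using \<open>e > 0\<close> by (rule order_tendstoD)
    then obtain N where "measure M (B - K N) < e" by (auto simp: eventually_sequentially)
    then show ?thesis using cl KB by (intro exI[of _ "K N"]) simp
  qed
  define G where "G = {B :: 'a set. \<forall>e>0. \<exists>K Q. closed K \<and> open Q \<and> K \<subseteq> B \<and> B \<subseteq> Q \<and> measure M (Q - K) < e}"
  have "B \<in> sigma_sets UNIV {S. open S}"
    using B by (simp add: borel_def)
  then have "B \<in> G"
  proof (induction rule: sigma_sets.induct)
    case (Basic B)
    then have "open B" by simp
    show ?case unfolding G_def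
    proof (intro CollectI allI impI)
      fix e :: real assume "e > 0"
      obtain K where "K \<subseteq> B" "closed K" "measure M (B - K) < e"
        using op[OF \<open>open B\<close> \<open>e > 0\<close>] by (elim exE conjE) (rule that)
      then show "\<exists>K Q. closed K \<and> open Q \<and> K \<subseteq> B \<and> B \<subseteq> Q \<and> measure M (Q - K) < e"
        using \<open>open B\<close> by (intro exI[of _ K] exI[of _ B]) simp
    qed
  next
    case Empty
    have "measure M ({} - {}) < e" if "e > 0" for e using that by simp
    then show ?case unfolding G_def by blast
  next
    case (Compl B)
    show ?case unfolding G_def
    proof (intro CollectI allI impI)
      fix e :: real assume "e > 0"
      then obtain K Q where KQ: "closed K" "open Q" "K \<subseteq> B" "B \<subseteq> Q" "measure M (Q - K) < e"
        using Compl.IH unfolding G_def by blast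
      have "- K - - Q = Q - K" by auto
      then show "\<exists>K Q. closed K \<and> open Q \<and> K \<subseteq> UNIV - B \<and> UNIV - B \<subseteq> Q \<and> measure M (Q - K) < e"
        using KQ by (intro exI[of _ "- Q"] exI[of _ "- K"]) auto
    qed
  next
    case (Union A)
    show ?case unfolding G_def
    proof (intro CollectI allI impI)
      fix e :: real assume "e > 0"
      then have pos: "e / 2 * (1 / 2) ^ Suc i > 0" for i by simp
      have "\<forall>i. \<exists>K Q. closed K \<and> open Q \<and> K \<subseteq> A i \<and> A i \<subseteq> Q \<and> measure M (Q - K) < e / 2 * (1 / 2) ^ Suc i"
        using Union.IH pos unfolding G_def by blast
      then obtain K Q where KQ: "\<And>i. closed (K i)" "\<And>i. open (Q i)" "\<And>i. K i \<subseteq> A i" "\<And>i. A i \<subseteq> Q i"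
          "\<And>i. measure M (Q i - K i) < e / 2 * (1 / 2) ^ Suc i" by metis
      have meas: "Q i - K i \<in> sets M" for i using KQ M by auto
      have sums: "(\<lambda>i. e / 2 * (1 / 2) ^ Suc i) sums (e / 2 * 1)"
        by (intro sums_mult power_half_series)
      have summ: "summable (\<lambda>i. measure M (Q i - K i))"
        by (rule summable_comparison_test'[OF sums_summable[OF sums]])
           (use KQ(5) in \<open>auto intro: less_imp_le\<close>)
      have "(\<lambda>n. measure M (\<Union>(range Q) - \<Union>(K ` {..<n}))) \<longlonglongrightarrow> measure M (\<Inter>n. \<Union>(range Q) - \<Union>(K ` {..<n}))"
      proof (rule finite_Lim_measure_decseq)
        have "closed (\<Union>(K ` {..<n}))" for n using KQ(1) by auto
        moreover have "open (\<Union>(range Q))" using KQ(2) by auto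
        ultimately show "range (\<lambda>n. \<Union>(range Q) - \<Union>(K ` {..<n})) \<subseteq> sets M" using M by auto
        show "decseq (\<lambda>n. \<Union>(range Q) - \<Union>(K ` {..<n}))" by (auto simp: decseq_def)
      qed
      moreover have "measure M (\<Inter>n. \<Union>(range Q) - \<Union>(K ` {..<n})) < e"
      proof -
        have "(\<Inter>n. \<Union>(range Q) - \<Union>(K ` {..<n})) \<subseteq> (\<Union>i. Q i - K i)" by auto
        then have "measure M (\<Inter>n. \<Union>(range Q) - \<Union>(K ` {..<n})) \<le> measure M (\<Union>i. Q i - K i)"
          using meas by (intro finite_measure_mono) auto
        also have "measure M (\<Union>i. Q i - K i) \<le> suminf (\<lambda>i. measure M (Q i - K i))"
          using meas summ by (intro finite_measure_subadditive_countably) auto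
        also have "\<dots> \<le> suminf (\<lambda>i. e / 2 * (1 / 2) ^ Suc i)"
          using KQ(5) by (intro suminf_le summ sums_summable[OF sums]) (auto intro: less_imp_le)
        also have "\<dots> = e / 2" using sums_unique[OF sums] by simp
        finally show ?thesis using \<open>e > 0\<close> by simp
      qed
      ultimately have "\<forall>\<^sub>F n in sequentially. measure M (\<Union>(range Q) - \<Union>(K ` {..<n})) < e"
        by (rule order_tendstoD)
      then obtain n where n: "measure M (\<Union>(range Q) - \<Union>(K ` {..<n})) < e" by (auto simp: eventually_sequentially)
      show "\<exists>K Q. closed K \<and> open Q \<and> K \<subseteq> \<Union> (range A) \<and> \<Union> (range A) \<subseteq> Q \<and> measure M (Q - K) < e"
      proof (intro exI conjI)
        show "closed (\<Union>(K ` {..<n}))" using KQ(1) by auto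
        show "open (\<Union>(range Q))" using KQ(2) by auto
      qed (use n KQ(3,4) in auto, blast+)
    qed
  qed
  then obtain K Q where KQ: "closed K" "open Q" "K \<subseteq> B" "B \<subseteq> Q" "measure M (Q - K) < e"
    using \<open>e > 0\<close> unfolding G_def by blast
  have "measure M (B - K) \<le> measure M (Q - K)"
    using KQ M by (intro finite_measure_mono) auto
  then show ?thesis using KQ by (intro exI[of _ K]) auto
qed

lemma label_entropy_eq_sum:
  assumes "space M = UNIV" "finite I" "range X \<subseteq> I"
  shows "label_entropy M X = - (\<Sum>v\<in>I. measure M (X -` {v}) * ln (measure M (X -` {v})))"
proof -
  have "X -` {v} = {}" if "v \<notin> range X" for v using that by auto
  then have "(\<Sum>v\<in>range X. measure M (X -` {v}) * ln (measure M (X -` {v})))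
      = (\<Sum>v\<in>I. measure M (X -` {v}) * ln (measure M (X -` {v})))"
    using assms by (intro sum.mono_neutral_left) auto
  then show ?thesis using assms by (simp add: label_entropy_def)
qed

context measure_preserving_system
begin

text \<open>
  Shrink each fibre of \<open>\<beta>\<close> to a set \<open>K v\<close> of the class \<open>\<C>\<close> with small loss. The new label records the value
  of \<open>\<beta>\<close> only off the shrunken fibres, that is, on a set of small measure, and so it has
  small entropy. Below, \<open>\<C>\<close> is the class of closed sets, so that a point has a neighbourhood
  meeting at most one of the shrunken fibres.
\<close>

lemma exists_low_entropy_exceptional_label:
  assumes reg: "\<And>B e. B \<in> sets M \<Longrightarrow> e > 0 \<Longrightarrow> \<exists>K\<subseteq>B. \<C> K \<and> K \<in> sets M \<and> measure M (B - K) < e"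
    and \<beta>: "simple_function M \<beta>" and "\<tau> > 0"
  shows "\<exists>K. (\<forall>v. \<C> (K v) \<and> K v \<in> sets M \<and> K v \<subseteq> \<beta> -` {v}) \<and>
    simple_function M (\<lambda>x. if x \<in> K (\<beta> x) then None else Some (\<beta> x)) \<and>
    label_entropy M (\<lambda>x. if x \<in> K (\<beta> x) then None else Some (\<beta> x)) < \<tau>"
proof -
  have sets\<beta>: "\<beta> -` {v} \<in> sets M" for v using simple_functionD(2)[OF \<beta>, of "{v}"] by simp
  have "\<forall>j v. \<exists>K\<subseteq>\<beta> -` {v}. \<C> K \<and> K \<in> sets M \<and> measure M (\<beta> -` {v} - K) < 1 / real (Suc j)"
    by (intro allI reg sets\<beta>) simp
  then obtain K where K: "\<And>j v. K j v \<subseteq> \<beta> -` {v}" "\<And>j v. \<C> (K j v)" "\<And>j v. K j v \<in> sets M"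
      "\<And>j v. measure M (\<beta> -` {v} - K j v) < 1 / real (Suc j)" by metis
  define r where "r j = (\<lambda>x. if x \<in> K j (\<beta> x) then None else Some (\<beta> x))" for j
  define I where "I = insert None (Some ` range \<beta>)"
  have finI: "finite I" using simple_functionD(1)[OF \<beta>] by (simp add: I_def)
  have rI: "range (r j) \<subseteq> I" for j by (auto simp: I_def r_def)
  have rSome: "r j -` {Some v} = \<beta> -` {v} - K j v" for j v by (auto simp: r_def split: if_splits)
  have rNone: "r j -` {None} = - (\<Union>v\<in>range \<beta>. r j -` {Some v})" for j
    by (auto simp: r_def split: if_splits)
  have rsets: "r j -` {v} \<in> sets M" for j v
  proof (cases v)
    case (Some w) then show ?thesis using sets\<beta> K(3) by (simp add: rSome)
  next
    case None
    have "(\<Union>v\<in>range \<beta>. r j -` {Some v}) \<in> sets M"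
      using simple_functionD(1)[OF \<beta>] sets\<beta> K(3) by (intro sets.finite_UN) (auto simp: rSome)
    then have "UNIV - (\<Union>v\<in>range \<beta>. r j -` {Some v}) \<in> sets M" using sets.compl_sets by fastforce
    then show ?thesis using None by (simp add: rNone Compl_eq_Diff_UNIV)
  qed
  have simple: "simple_function M (r j)" for j
    unfolding simple_function_def using finite_subset[OF rI finI] rsets by simp
  have lim: "(\<lambda>j. measure M (r j -` {v})) \<longlonglongrightarrow> (if v = None then 1 else 0)" if "v \<in> I" for v
  proof -
    have S: "(\<lambda>j. measure M (r j -` {Some w})) \<longlonglongrightarrow> 0" for w
    proof (rule tendsto_sandwich[OF always_eventually always_eventually])
      show "\<forall>j. 0 \<le> measure M (r j -` {Some w})" by simp
      show "\<forall>j. measure M (r j -` {Some w}) \<le> 1 / real (Suc j)" using K(4) by (auto simp: rSome intro: less_imp_le)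
      show "(\<lambda>j. 1 / real (Suc j)) \<longlonglongrightarrow> 0" by real_asymp
    qed simp
    have "measure M (r j -` {None}) = 1 - (\<Sum>w\<in>range \<beta>. measure M (r j -` {Some w}))" for j
    proof -
      have "measure M (\<Union>v\<in>range \<beta>. r j -` {Some v}) = (\<Sum>w\<in>range \<beta>. measure M (r j -` {Some w}))"
        using simple_functionD(1)[OF \<beta>] rsets
        by (intro finite_measure_finite_Union) (auto simp: disjoint_family_on_def)
      moreover have "(\<Union>v\<in>range \<beta>. r j -` {Some v}) \<in> sets M"
        using simple_functionD(1)[OF \<beta>] rsets by (intro sets.finite_UN) auto
      then have "measure M (- (\<Union>v\<in>range \<beta>. r j -` {Some v})) = 1 - measure M (\<Union>v\<in>range \<beta>. r j -` {Some v})"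
        using prob_compl[of "\<Union>v\<in>range \<beta>. r j -` {Some v}"] by (simp add: Compl_eq_Diff_UNIV)
      ultimately show ?thesis by (simp add: rNone)
    qed
    moreover have "(\<lambda>j. 1 - (\<Sum>w\<in>range \<beta>. measure M (r j -` {Some w}))) \<longlonglongrightarrow> 1 - (\<Sum>w\<in>range \<beta>. 0)"
      by (intro tendsto_diff tendsto_const tendsto_sum S)
    ultimately have "(\<lambda>j. measure M (r j -` {None})) \<longlonglongrightarrow> 1" by simp
    with S show ?thesis by (cases v) auto
  qed
  have "(\<lambda>j. label_entropy M (r j)) \<longlonglongrightarrow>
      - (\<Sum>v\<in>I. (if v = None then 1 else 0) * ln (if v = None then 1 else (0::real)))"
    using tendsto_sum_mult_ln[where I = I and m = "\<lambda>j v. measure M (r j -` {v})", OF finI lim]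
    by (simp add: label_entropy_eq_sum[OF _ finI rI])
  moreover have "(\<Sum>v\<in>I. (if v = None then 1 else 0) * ln (if v = None then 1 else (0::real))) = 0"
    by (intro sum.neutral) auto
  ultimately have "(\<lambda>j. label_entropy M (r j)) \<longlonglongrightarrow> 0" by simp
  then have "\<forall>\<^sub>F j in sequentially. label_entropy M (r j) < \<tau>" using \<open>\<tau> > 0\<close> by (rule order_tendstoD)
  then obtain j where "label_entropy M (r j) < \<tau>" by (auto simp: eventually_sequentially)
  then show ?thesis using K simple[of j] unfolding r_def by (intro exI[of _ "K j"]) blast
qed

end

text \<open>
  The label \<open>\<alpha>\<close> is subordinate to the cover \<open>\<U>\<close>. The value of an arbitrary \<open>\<beta>\<close> along an orbit of length
  \<open>n\<close> is recovered from three pieces of information: the itinerary of \<open>\<alpha>\<close>; the itinerary of a label \<open>r\<close>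
  of entropy less than \<open>\<tau>\<close> that gives the value of \<open>\<beta>\<close> at the times when the orbit is outside the disjoint
  closed sets \<open>K v\<close>; and one of at most \<open>C exp (\<delta> n)\<close> pieces. At the remaining times the piece
  determines \<open>\<beta>\<close>, because it lies in some \<open>V v\<close> and this set meets no \<open>K w\<close> other than \<open>K v\<close>.
\<close>

lemma entropy_rate_le_of_conditional_entropy:
  fixes f :: "'a::topological_space \<Rightarrow> 'a" and \<alpha> :: "'a \<Rightarrow> 'c" and \<beta> :: "'a \<Rightarrow> 'b"
  assumes zero: "closed_sets_are_zero_sets TYPE('a)" and sets: "sets M = sets borel"
    and mps: "measure_preserving_system M f"
    and tail: "conditional_entropy_at_most f \<U> \<delta>" and "\<delta> \<ge> 0"
    and \<alpha>: "simple_function M \<alpha>" and u: "\<And>x. x \<in> u (\<alpha> x)" "\<And>x. u (\<alpha> x) \<in> \<U>"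
    and \<beta>: "simple_function M \<beta>"
  shows "entropy_rate M f \<beta> \<le> entropy_rate M f \<alpha> + \<delta>"
proof (rule field_le_epsilon)
  fix \<tau> :: real assume "\<tau> > 0"
  interpret measure_preserving_system M f by fact
  have reg: "\<exists>K\<subseteq>B. closed K \<and> K \<in> sets M \<and> measure M (B - K) < e" if Be: "B \<in> sets M" "e > 0" for B e
  proof -
    obtain K where "K \<subseteq> B" "closed K" "measure M (B - K) < e"
      using closed_inner_regular[OF zero sets finite_measure_axioms Be(1)[unfolded sets] Be(2)]
      by (elim exE conjE) (rule that)
    moreover have "K \<in> sets M" using \<open>closed K\<close> by (simp add: sets)
    ultimately show ?thesis by (intro exI[of _ K] conjI)
  qed
  obtain K where K: "\<And>v. closed (K v)" "\<And>v. K v \<subseteq> \<beta> -` {v}"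
    and r0: "simple_function M (\<lambda>x. if x \<in> K (\<beta> x) then None else Some (\<beta> x))"
      "label_entropy M (\<lambda>x. if x \<in> K (\<beta> x) then None else Some (\<beta> x)) < \<tau>"
    using exists_low_entropy_exceptional_label[OF reg \<beta> \<open>\<tau> > 0\<close>] by blast
  define r where "r = (\<lambda>x. if x \<in> K (\<beta> x) then None else Some (\<beta> x))"
  have r: "simple_function M r" "label_entropy M r < \<tau>" using r0 by (simp_all add: r_def)
  define V where "V v = - (\<Union>w\<in>range \<beta> - {v}. K w)" for v
  have fin\<beta>: "finite (range \<beta>)" using simple_functionD(1)[OF \<beta>] by simp
  have cover: "finite_open_cover (V ` range \<beta>)"
    unfolding finite_open_cover_def
  proof (intro conjI ballI)
    show "finite (V ` range \<beta>)" using fin\<beta> by simp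
    show "open U" if "U \<in> V ` range \<beta>" for U
      using that K(1) fin\<beta> by (auto simp: V_def intro!: open_Compl closed_UN)
    have "x \<in> V (\<beta> x)" for x
    proof -
      have "x \<notin> K w" if "w \<noteq> \<beta> x" for w using K(2)[of w] that by auto
      then show ?thesis by (auto simp: V_def)
    qed
    then show "\<Union> (V ` range \<beta>) = UNIV" by blast
  qed
  obtain C0 where C0: "\<And>n s. (\<forall>i<n. s i \<in> \<U>) \<Longrightarrow>
      \<exists>\<E>. finite \<E> \<and> real (card \<E>) \<le> C0 * exp (\<delta> * real n) \<and>
        {y. \<forall>i<n. (f ^^ i) y \<in> s i} \<subseteq> \<Union>\<E> \<and> (\<forall>E\<in>\<E>. \<forall>i<n. \<exists>W\<in>V ` range \<beta>. (f ^^ i) ` E \<subseteq> W)"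
    using tail[unfolded conditional_entropy_at_most_def, rule_format, OF cover]
    by (elim exE) (rule that, blast)
  define C where "C = max C0 1"
  define Y where "Y n = itinerary f (\<lambda>x. (\<alpha> x, r x)) n" for n
  have sY: "simple_function M (Y n)" for n
    unfolding Y_def by (intro simple_function_itinerary simple_function_Pair \<alpha> r)
  have count: "real (card (itinerary f \<beta> n ` (Y n -` {y} \<inter> space M))) \<le> C * exp (\<delta> * real n)" for n y
  proof (cases "Y n -` {y} = {}")
    case True then show ?thesis by (simp add: C_def)
  next
    case False
    then obtain x0 where x0: "Y n x0 = y" by auto
    have "\<forall>i<n. u (fst (y ! i)) \<in> \<U>" using u(2) x0 by (auto simp: Y_def)
    from C0[OF this] obtain \<E> where \<E>: "finite \<E>" "real (card \<E>) \<le> C0 * exp (\<delta> * real n)"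
        "{z. \<forall>i<n. (f ^^ i) z \<in> u (fst (y ! i))} \<subseteq> \<Union>\<E>"
        "\<forall>E\<in>\<E>. \<forall>i<n. \<exists>W\<in>V ` range \<beta>. (f ^^ i) ` E \<subseteq> W" by blast
    from \<E>(4) have "\<forall>E\<in>\<E>. \<forall>i<n. \<exists>v. (f ^^ i) ` E \<subseteq> V v" by blast
    then obtain t where t: "\<And>E i. E \<in> \<E> \<Longrightarrow> i < n \<Longrightarrow> (f ^^ i) ` E \<subseteq> V (t E i)" by metis
    define dec where "dec E = map (\<lambda>i. case snd (y ! i) of Some v \<Rightarrow> v | None \<Rightarrow> t E i) [0..<n]" for E
    have "itinerary f \<beta> n ` (Y n -` {y} \<inter> space M) \<subseteq> dec ` \<E>"
    proof
      fix l assume "l \<in> itinerary f \<beta> n ` (Y n -` {y} \<inter> space M)"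
      then obtain x where x: "Y n x = y" "l = itinerary f \<beta> n x" by auto
      have y: "y ! i = (\<alpha> ((f ^^ i) x), r ((f ^^ i) x))" if "i < n" for i
        using x(1) that by (auto simp: Y_def)
      have "x \<in> {z. \<forall>i<n. (f ^^ i) z \<in> u (fst (y ! i))}" using u(1) y by simp
      then obtain E where E: "E \<in> \<E>" "x \<in> E" using \<E>(3) by blast
      have "\<beta> ((f ^^ i) x) = (case r ((f ^^ i) x) of Some v \<Rightarrow> v | None \<Rightarrow> t E i)" if "i < n" for i
      proof (cases "(f ^^ i) x \<in> K (\<beta> ((f ^^ i) x))")
        case True
        moreover have "(f ^^ i) x \<in> V (t E i)" using t[OF E(1) that] E(2) by auto
        ultimately have "t E i = \<beta> ((f ^^ i) x)" by (auto simp: V_def)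
        then show ?thesis using True by (simp add: r_def)
      qed (simp add: r_def)
      then have "l = dec E" unfolding x(2) itinerary_def dec_def by (intro map_cong) (auto simp: y)
      then show "l \<in> dec ` \<E>" using E by blast
    qed
    then have "card (itinerary f \<beta> n ` (Y n -` {y} \<inter> space M)) \<le> card \<E>"
      by (meson \<E>(1) card_image_le card_mono finite_imageI le_trans)
    also have "real (card \<E>) \<le> C * exp (\<delta> * real n)"
      using \<E>(2) by (rule order_trans) (simp add: C_def)
    finally show ?thesis by simp
  qed
  have bound: "label_entropy M (itinerary f \<beta> n) / real n
      \<le> label_entropy M (itinerary f \<alpha> n) / real n + \<tau> + (ln C / real n + \<delta>)" if "n \<ge> 1" for n
  proof -
    have K1: "1 \<le> C * exp (\<delta> * real n)"
      using mult_mono[of 1 C 1 "exp (\<delta> * real n)"] \<open>\<delta> \<ge> 0\<close> by (simp add: C_def)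
    have "label_entropy M (itinerary f \<beta> n) \<le> label_entropy M (Y n) + ln (C * exp (\<delta> * real n))"
      by (rule label_entropy_le_of_multiplicity[OF simple_function_itinerary[OF \<beta>] sY K1 count])
    also have "ln (C * exp (\<delta> * real n)) = ln C + \<delta> * real n"
      by (subst ln_mult) (auto simp: C_def)
    also have "label_entropy M (Y n) \<le> label_entropy M (\<lambda>x. (itinerary f \<alpha> n x, itinerary f r n x))"
      by (rule label_entropy_le_of_factor[where h = "\<lambda>(l, l'). zip l l'"])
         (simp_all add: Y_def itinerary_Pair simple_function_Pair simple_function_itinerary \<alpha> r)
    also have "\<dots> \<le> label_entropy M (itinerary f \<alpha> n) + label_entropy M (itinerary f r n)"
      by (intro label_entropy_Pair_le simple_function_itinerary \<alpha> r)
    also have "label_entropy M (itinerary f r n) \<le> real n * label_entropy M r"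
      by (rule label_entropy_itinerary_le[OF r(1)])
    also have "\<dots> \<le> real n * \<tau>" using r(2) by (intro mult_left_mono) auto
    finally have "label_entropy M (itinerary f \<beta> n)
        \<le> label_entropy M (itinerary f \<alpha> n) + real n * \<tau> + (ln C + \<delta> * real n)" by simp
    then have "label_entropy M (itinerary f \<beta> n) / real n
        \<le> (label_entropy M (itinerary f \<alpha> n) + real n * \<tau> + (ln C + \<delta> * real n)) / real n"
      by (rule divide_right_mono) simp
    then show ?thesis using that by (simp add: add_divide_distrib)
  qed
  have "(\<lambda>n. ln C / real n) \<longlonglongrightarrow> 0" by (rule lim_const_over_n)
  then have "(\<lambda>n. label_entropy M (itinerary f \<alpha> n) / real n + \<tau> + (ln C / real n + \<delta>))
      \<longlonglongrightarrow> entropy_rate M f \<alpha> + \<tau> + (0 + \<delta>)"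
    by (intro tendsto_add entropy_rate_tendsto[OF \<alpha>] tendsto_const)
  with entropy_rate_tendsto[OF \<beta>] have "entropy_rate M f \<beta> \<le> entropy_rate M f \<alpha> + \<tau> + (0 + \<delta>)"
    by (rule LIMSEQ_le) (use bound in blast)
  then show "entropy_rate M f \<beta> \<le> entropy_rate M f \<alpha> + \<delta> + \<tau>" by simp
qed

text \<open>
  The level sets of a continuous function are disjoint, so only countably many of them have positive
  measure; superlevel sets at the other levels have null frontier.
\<close>

lemma exists_null_frontier_neighbourhood:
  fixes x :: "'a::topological_space"
  assumes zero: "closed_sets_are_zero_sets TYPE('a)" and sets: "sets M = sets borel" "finite_measure M"
    and U: "open U" "x \<in> U"
  shows "\<exists>Q\<subseteq>U. open Q \<and> x \<in> Q \<and> measure M (frontier Q) = 0"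
proof -
  interpret finite_measure M by fact
  obtain \<phi> :: "'a \<Rightarrow> real" where \<phi>: "continuous_on UNIV \<phi>" "\<And>x. 0 \<le> \<phi> x" "- U = {x. \<phi> x = 0}"
    using zero U unfolding closed_sets_are_zero_sets_def closed_def by (metis double_complement)
  have m: "\<phi> \<in> borel_measurable M"
    using borel_measurable_continuous_onI[OF \<phi>(1)] measurable_cong_sets[OF sets(1) refl] by blast
  interpret D: finite_measure "distr M borel \<phi>" using m by (rule finite_measure_distr)
  have "countable {t. measure (distr M borel \<phi>) {t} \<noteq> 0}" by (rule D.countable_support)
  moreover have "\<phi> x > 0" using \<phi>(2)[of x] \<phi>(3) U by force
  then have "uncountable {0<..<\<phi> x}" by (simp add: uncountable_open_interval)
  ultimately have "\<not> {0<..<\<phi> x} \<subseteq> {t. measure (distr M borel \<phi>) {t} \<noteq> 0}"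
    by (meson countable_subset)
  then obtain t where t: "0 < t" "t < \<phi> x" "measure (distr M borel \<phi>) {t} = 0"
    by (auto simp: subset_iff)
  let ?Q = "{y. t < \<phi> y}"
  have op: "open ?Q" by (intro open_Collect_less \<phi> continuous_intros)
  have "closed {y. t \<le> \<phi> y}" by (intro closed_Collect_le \<phi> continuous_intros)
  then have "closure ?Q \<subseteq> {y. t \<le> \<phi> y}" by (intro closure_minimal) auto
  then have fr: "frontier ?Q \<subseteq> \<phi> -` {t}" using op by (auto simp: frontier_def interior_open)
  have sp: "space M = UNIV" using sets_eq_imp_space_eq[OF sets(1)] by simp
  have "measure M (frontier ?Q) \<le> measure M (\<phi> -` {t} \<inter> space M)"
    using fr sp measurable_sets[OF m, of "{t}"] by (intro finite_measure_mono) auto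
  also have "\<dots> = 0" using t(3) m by (simp add: measure_distr)
  finally have "measure M (frontier ?Q) = 0" by (simp add: order_antisym)
  moreover have "?Q \<subseteq> U" using \<phi>(3) t(1) by force
  ultimately show ?thesis using op t(2) by blast
qed

text \<open>
  Only one partition is needed for given \<open>\<mu>\<close> and \<open>\<delta>\<close>: the one generated by a finite cover of the
  space by open sets with \<open>\<mu>\<close>-null frontier that is subordinate to the cover provided by
  asymptotic h-expansiveness.
\<close>

theorem KS_entropy_upper_semicontinuous:
  fixes f :: "'a::topological_space \<Rightarrow> 'a"
  assumes cpt: "compact (UNIV :: 'a set)" and zero: "closed_sets_are_zero_sets TYPE('a)"
    and f: "continuous_on UNIV f" and exp: "asymptotically_h_expansive f"
  shows "upper_semicontinuous (subtopology weak_star_topology (invariant_measures f)) (\<lambda>\<mu>. KS_entropy \<mu> f)"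
  unfolding upper_semicontinuous_def
proof
  fix \<mu> assume "\<mu> \<in> topspace (subtopology weak_star_topology (invariant_measures f))"
  then have \<mu>: "\<mu> \<in> invariant_measures f" by simp
  note mps = invariant_measures_measure_preserving[OF _ f]
  have setsB: "sets \<nu> = sets borel" if "\<nu> \<in> invariant_measures f" for \<nu>
    using that by (auto simp: invariant_measures_def borel_probability_measures_def)
  interpret \<mu>: measure_preserving_system \<mu> f by (rule mps[OF \<mu>])
  show "Limsup (at_invariant f \<mu>) (\<lambda>\<mu>. KS_entropy \<mu> f) \<le> KS_entropy \<mu> f"
  proof (rule ereal_le_epsilon2)
    fix e :: real assume "e > 0"
    define \<delta> where "\<delta> = e / 3"
    have "\<delta> > 0" using \<open>e > 0\<close> by (simp add: \<delta>_def)
    then obtain \<U> where \<U>: "finite_open_cover \<U>" "conditional_entropy_at_most f \<U> \<delta>"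
      using exp unfolding asymptotically_h_expansive_def by blast
    have "\<exists>U Q. U \<in> \<U> \<and> Q \<subseteq> U \<and> open Q \<and> x \<in> Q \<and> measure \<mu> (frontier Q) = 0" for x
    proof -
      obtain U where U: "U \<in> \<U>" "x \<in> U" "open U" using \<U>(1) unfolding finite_open_cover_def by blast
      then show ?thesis
        using exists_null_frontier_neighbourhood[OF zero setsB[OF \<mu>] \<mu>.finite_measure_axioms U(3,2)] by blast
    qed
    then obtain U Q where UQ: "\<And>x. U x \<in> \<U>" "\<And>x. Q x \<subseteq> U x" "\<And>x. open (Q x)" "\<And>x. x \<in> Q x"
        "\<And>x. measure \<mu> (frontier (Q x)) = 0" by metis
    obtain P where P: "finite P" "UNIV \<subseteq> (\<Union>p\<in>P. Q p)"
    proof (rule compactE_image[OF cpt, of UNIV Q])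
      show "UNIV \<subseteq> (\<Union>p\<in>UNIV. Q p)" using UQ(4) by blast
    qed (use UQ(3) in blast)+
    define \<alpha> where "\<alpha> x = {p \<in> P. x \<in> Q p}" for x
    define u where "u S = U (SOME p. p \<in> S)" for S
    have \<alpha>ne: "(SOME p. p \<in> \<alpha> x) \<in> \<alpha> x" for x
    proof -
      obtain p where "p \<in> P" "x \<in> Q p" using P(2) by blast
      then have "p \<in> \<alpha> x" by (simp add: \<alpha>_def)
      then show ?thesis by (rule someI)
    qed
    have u: "x \<in> u (\<alpha> x)" "u (\<alpha> x) \<in> \<U>" for x
    proof -
      have "x \<in> Q (SOME p. p \<in> \<alpha> x)" using \<alpha>ne[of x] unfolding \<alpha>_def by blast
      then show "x \<in> u (\<alpha> x)" "u (\<alpha> x) \<in> \<U>" unfolding u_def using UQ(1,2) by blast+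
    qed
    have fin\<alpha>: "finite (range \<alpha>)"
      by (rule finite_subset[of _ "Pow P"]) (auto simp: \<alpha>_def P(1))
    have \<alpha>borel: "\<alpha> -` {S} \<in> sets borel" for S
    proof -
      have meas: "{x. x \<in> Q p \<longleftrightarrow> p \<in> S} \<in> sets borel" for p
      proof (cases "p \<in> S")
        case False
        then have "{x. x \<in> Q p \<longleftrightarrow> p \<in> S} = - Q p" by auto
        then show ?thesis using UQ(3)[of p] by auto
      qed (use UQ(3) in simp)
      have "\<alpha> -` {S} = {x. S \<subseteq> P \<and> (\<forall>p\<in>P. x \<in> Q p \<longleftrightarrow> p \<in> S)}"
        unfolding \<alpha>_def vimage_def by fastforce
      also have "\<dots> = (if S \<subseteq> P then UNIV - (\<Union>p\<in>P. - {x. x \<in> Q p \<longleftrightarrow> p \<in> S}) else {})" by auto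
      also have "\<dots> \<in> sets borel"
      proof -
        have "(\<Union>p\<in>P. - {x. x \<in> Q p \<longleftrightarrow> p \<in> S}) \<in> sets borel"
          by (rule sets.finite_UN[OF P(1) borel_comp[OF meas]])
        then show ?thesis using borel_comp[unfolded Compl_eq_Diff_UNIV] by simp
      qed
      finally show ?thesis .
    qed
    have \<alpha>simple: "simple_function \<nu> \<alpha>" if "\<nu> \<in> invariant_measures f" for \<nu>
      using fin\<alpha> \<alpha>borel setsB[OF that] sets_eq_imp_space_eq[OF setsB[OF that]]
      by (simp add: simple_function_def)
    define N where "N = (\<Union>p\<in>P. frontier (Q p))"
    have N: "N \<in> sets \<mu>" "measure \<mu> N = 0"
    proof -
      have fs: "frontier (Q p) \<in> sets \<mu>" for p using setsB[OF \<mu>] by simp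
      show "N \<in> sets \<mu>" using fs P(1) by (auto simp: N_def)
      have "measure \<mu> N \<le> (\<Sum>p\<in>P. measure \<mu> (frontier (Q p)))"
        unfolding N_def using P(1) fs by (intro measure_UNION_le) auto
      then show "measure \<mu> N = 0" using UQ(5) by (simp add: order_antisym)
    qed
    (* Off the preimages of N, all memberships that determine the itinerary are locally constant. *)
    have frontier: "measure \<mu> (frontier (itinerary f \<alpha> n -` {l})) = 0" for n l
    proof -
      have "frontier (itinerary f \<alpha> n -` {l}) \<subseteq> (\<Union>i<n. (f ^^ i) -` N)"
      proof (rule ccontr)
        let ?D = "itinerary f \<alpha> n -` {l}"
        assume "\<not> ?thesis"
        then obtain x where x: "x \<in> frontier ?D" "\<And>i. i < n \<Longrightarrow> (f ^^ i) x \<notin> N" by blast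
        define W where "W = (\<Inter>i<n. \<Inter>p\<in>P. (f ^^ i) -` (if (f ^^ i) x \<in> Q p then Q p else - closure (Q p)))"
        have "open W"
          unfolding W_def using P(1) UQ(3)
          by (intro open_INT ballI finite_lessThan open_vimage[OF _ continuous_on_funpow[OF f]]) auto
        moreover have "x \<in> W"
          using x(2) UQ(3) unfolding W_def N_def frontier_def by (auto simp: interior_open)
        moreover have "itinerary f \<alpha> n y = itinerary f \<alpha> n x" if "y \<in> W" for y
        proof -
          have "\<alpha> ((f ^^ i) y) = \<alpha> ((f ^^ i) x)" if "i < n" for i
          proof -
            have "(f ^^ i) y \<in> (if (f ^^ i) x \<in> Q p then Q p else - closure (Q p))" if "p \<in> P" for p
              using \<open>y \<in> W\<close> \<open>i < n\<close> that unfolding W_def by blast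
            then have "(f ^^ i) y \<in> Q p \<longleftrightarrow> (f ^^ i) x \<in> Q p" if "p \<in> P" for p
              using closure_subset[of "Q p"] that by (metis Compl_iff subsetD)
            then show ?thesis unfolding \<alpha>_def by blast
          qed
          then show ?thesis by (simp add: itinerary_eq_iff)
        qed
        then have "W \<subseteq> ?D \<or> W \<subseteq> - ?D" by auto
        ultimately have "x \<in> interior ?D \<or> x \<in> interior (- ?D)" by (meson interiorI)
        then show False using x(1) by (auto simp: frontier_def interior_complement)
      qed
      moreover have "measure \<mu> (\<Union>i<n. (f ^^ i) -` N) = 0"
      proof -
        have s: "(f ^^ i) -` N \<in> sets \<mu>" for i using measurable_sets[OF \<mu>.measurable_funpow N(1)] by simp
        have "measure \<mu> (\<Union>i<n. (f ^^ i) -` N) \<le> (\<Sum>i<n. measure \<mu> ((f ^^ i) -` N))"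
          using s by (intro measure_UNION_le) auto
        then show ?thesis using \<mu>.invariant_funpow[OF N(1)] N(2) by (simp add: order_antisym)
      qed
      moreover have "(\<Union>i<n. (f ^^ i) -` N) \<in> sets \<mu>"
        using measurable_sets[OF \<mu>.measurable_funpow N(1)] by auto
      ultimately show ?thesis
        by (metis \<mu>.finite_measure_mono measure_nonneg order_antisym)
    qed
    have "\<forall>\<^sub>F n in sequentially. label_entropy \<mu> (itinerary f \<alpha> n) / real n < entropy_rate \<mu> f \<alpha> + \<delta>"
      using \<open>\<delta> > 0\<close> by (intro order_tendstoD(2)[OF \<mu>.entropy_rate_tendsto[OF \<alpha>simple[OF \<mu>]]]) simp
    then obtain n where n: "n \<ge> 1" "label_entropy \<mu> (itinerary f \<alpha> n) / real n < entropy_rate \<mu> f \<alpha> + \<delta>"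
      unfolding eventually_sequentially by (metis max.cobounded1 max.cobounded2)
    define I where "I = range (itinerary f \<alpha> n)"
    have finI: "finite I"
      using \<mu>.simple_function_itinerary[OF \<alpha>simple[OF \<mu>]] by (auto simp: I_def simple_function_def)
    have borelI: "itinerary f \<alpha> n -` {l} \<in> sets borel" for l
      using simple_functionD(2)[OF \<mu>.simple_function_itinerary[OF \<alpha>simple[OF \<mu>]], of n "{l}"]
      by (simp add: setsB[OF \<mu>])
    have "((\<lambda>\<nu>. - (\<Sum>l\<in>I. measure \<nu> (itinerary f \<alpha> n -` {l}) * ln (measure \<nu> (itinerary f \<alpha> n -` {l}))))
        \<longlongrightarrow> - (\<Sum>l\<in>I. measure \<mu> (itinerary f \<alpha> n -` {l}) * ln (measure \<mu> (itinerary f \<alpha> n -` {l})))) (at_invariant f \<mu>)"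
      by (intro tendsto_sum_mult_ln finI tendsto_measure_of_null_frontier[OF zero \<mu>] borelI frontier measure_nonneg)
    moreover have "- (\<Sum>l\<in>I. measure \<mu> (itinerary f \<alpha> n -` {l}) * ln (measure \<mu> (itinerary f \<alpha> n -` {l})))
        = label_entropy \<mu> (itinerary f \<alpha> n)"
      by (rule label_entropy_eq_sum[symmetric]) (simp_all add: finI I_def[symmetric])
    ultimately have "\<forall>\<^sub>F \<nu> in at_invariant f \<mu>. - (\<Sum>l\<in>I. measure \<nu> (itinerary f \<alpha> n -` {l}) * ln (measure \<nu> (itinerary f \<alpha> n -` {l})))
         < label_entropy \<mu> (itinerary f \<alpha> n) + real n * \<delta>"
      using n(1) \<open>\<delta> > 0\<close> by (intro order_tendstoD(2)) auto
    then have "\<forall>\<^sub>F \<nu> in at_invariant f \<mu>. KS_entropy \<nu> f \<le> KS_entropy \<mu> f + ereal e"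
      using eventually_invariant
    proof eventually_elim
      case (elim \<nu>)
      interpret \<nu>: measure_preserving_system \<nu> f by (rule mps[OF elim(2)])
      have "label_entropy \<nu> (itinerary f \<alpha> n) < label_entropy \<mu> (itinerary f \<alpha> n) + real n * \<delta>"
        using elim(1) by (subst label_entropy_eq_sum[OF \<nu>.space_UNIV finI]) (simp_all add: I_def)
      then have "label_entropy \<nu> (itinerary f \<alpha> n) / real n < label_entropy \<mu> (itinerary f \<alpha> n) / real n + \<delta>"
        using n(1) by (simp add: field_simps)
      then have *: "entropy_rate \<nu> f \<alpha> + \<delta> \<le> entropy_rate \<mu> f \<alpha> + e"
        using \<nu>.entropy_rate_le[OF \<alpha>simple[OF elim(2)] n(1)] n(2) unfolding \<delta>_def by linarith
      have "KS_entropy \<nu> f \<le> ereal (entropy_rate \<nu> f \<alpha> + \<delta>)"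
        by (rule KS_entropy_le[OF \<nu>.space_UNIV])
           (simp add: entropy_rate_le_of_conditional_entropy[OF zero setsB[OF elim(2)]
              \<nu>.measure_preserving_system_axioms \<U>(2) less_imp_le[OF \<open>\<delta> > 0\<close>] \<alpha>simple[OF elim(2)] u])
      also have "\<dots> \<le> ereal (entropy_rate \<mu> f \<alpha>) + ereal e" using * by simp
      also have "\<dots> \<le> KS_entropy \<mu> f + ereal e"
        by (intro add_right_mono entropy_rate_le_KS_entropy \<alpha>simple[OF \<mu>]) simp
      finally show ?case .
    qed
    then show "Limsup (at_invariant f \<mu>) (\<lambda>\<mu>. KS_entropy \<mu> f) \<le> KS_entropy \<mu> f + ereal e"
      by (rule Limsup_bounded)
  qed
qed

section \<open>Tiles of an open map\<close>

text \<open>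
  The image of \<open>W\<close> is open, and it is relatively closed in the component of \<open>S\<close> that contains it,
  since \<open>W\<close> is the trace on \<open>f -` S\<close> of a closed set.
\<close>

lemma open_closed_image_component:
  fixes f :: "'a::topological_space \<Rightarrow> 'b::topological_space"
  assumes f: "continuous_on UNIV f" and op: "\<And>S. open S \<Longrightarrow> open (f ` S)"
    and cl: "\<And>S. closed S \<Longrightarrow> closed (f ` S)"
    and W: "W \<in> components (f -` S)" "open W"
  shows "f ` W \<in> components S"
proof -
  have ne: "W \<noteq> {}" and con: "connected W" and sub: "W \<subseteq> f -` S"
    using W in_components_nonempty in_components_connected in_components_subset by blast+
  have "connected (f ` W)" using con continuous_on_subset[OF f] by (intro connected_continuous_image) auto
  then obtain W' where W': "W' \<in> components S" "f ` W \<subseteq> W'"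
    using exists_component_superset[of "f ` W" S] ne sub by (metis image_is_empty image_subset_iff_subset_vimage subset_empty)
  have W'S: "W' \<subseteq> S" using W'(1) by (rule in_components_subset)
  obtain F where F: "closed F" "W = f -` S \<inter> F"
    using closedin_component[OF W(1)] by (auto simp: closedin_closed)
  have "f ` W = W' \<inter> f ` F"
    using F(2) W'(2) W'S by auto
  then have "closedin (top_of_set W') (f ` W)" using cl[OF F(1)] by (auto simp: closedin_closed)
  moreover have "openin (top_of_set W') (f ` W)" using op[OF W(2)] W'(2) by (auto simp: openin_open)
  ultimately have "f ` W = W'"
    using in_components_connected[OF W'(1)] ne unfolding connected_clopen by blast
  then show ?thesis using W'(1) by simp
qed

text \<open>
  Each member of \<open>\<W>\<close> contains a preimage of \<open>p\<close>, and disjoint sets contain different ones.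
\<close>

lemma card_sets_over_common_image:
  assumes disj: "\<And>W W'. W \<in> \<W> \<Longrightarrow> W' \<in> \<W> \<Longrightarrow> W \<noteq> W' \<Longrightarrow> W \<inter> W' = {}"
    and img: "\<And>W. W \<in> \<W> \<Longrightarrow> f ` W = Z" and sub: "\<And>W. W \<in> \<W> \<Longrightarrow> W \<subseteq> G" and p: "p \<in> Z"
    and fin: "finite (f -` {p} \<inter> G)"
  shows "finite \<W> \<and> card \<W> \<le> card (f -` {p} \<inter> G)"
proof -
  have "\<forall>W\<in>\<W>. \<exists>w. w \<in> W \<and> f w = p" using img p by (metis imageE)
  then obtain w where w: "\<And>W. W \<in> \<W> \<Longrightarrow> w W \<in> W \<and> f (w W) = p" by metis
  have inj: "inj_on w \<W>"
  proof (rule inj_onI)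
    fix W W' assume "W \<in> \<W>" "W' \<in> \<W>" "w W = w W'"
    then show "W = W'" using disj w by (metis IntI emptyE)
  qed
  have "w ` \<W> \<subseteq> f -` {p} \<inter> G" using w sub by blast
  then show ?thesis
    using inj fin by (meson card_inj_on_le finite_imageD finite_subset)
qed

text \<open>
  Each block of \<open>N\<close> consecutive integers contains at most one element of \<open>J\<close>.
\<close>

lemma card_sparse_le:
  fixes J :: "nat set"
  assumes J: "J \<subseteq> {..<n}" and N: "N \<ge> 1"
    and sparse: "\<And>i j. i \<in> J \<Longrightarrow> j \<in> J \<Longrightarrow> i < j \<Longrightarrow> N < j - i"
  shows "card J \<le> Suc (n div N)"
proof -
  have "i div N \<noteq> j div N" if "i \<in> J" "j \<in> J" "i < j" for i j
  proof
    assume "i div N = j div N"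
    then have "i div N * N = j div N * N" by simp
    then have "j - i < N"
      using div_mult_mod_eq[of i N] div_mult_mod_eq[of j N] mod_less_divisor[of N j] N by linarith
    then show False using sparse[OF that] by simp
  qed
  then have "inj_on (\<lambda>i. i div N) J" by (intro inj_onI) (metis linorder_neqE_nat)
  moreover have "(\<lambda>i. i div N) ` J \<subseteq> {..n div N}" using J by (auto intro!: div_le_mono)
  ultimately have "card J \<le> card {..n div N}" by (intro card_inj_on_le) auto
  then show ?thesis by simp
qed

text \<open>
  The topological properties of an expanding Thurston map without periodic critical points on
  which the counting argument rests.
  The function \<open>deg\<close> bounds the local multiplicity, and \<open>P\<close> plays the role of the set of critical
  points.
\<close>

locale finite_branching_tiles =
  fixes f :: "'a::topological_space \<Rightarrow> 'a" and C :: "'a set" and deg :: "'a \<Rightarrow> nat" and P :: "'a set"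
  assumes compact_space: "compact (UNIV :: 'a set)"
    and hausdorff: "\<And>x y :: 'a. x \<noteq> y \<Longrightarrow> \<exists>U V. open U \<and> open V \<and> x \<in> U \<and> y \<in> V \<and> U \<inter> V = {}"
    and zero_sets: "closed_sets_are_zero_sets TYPE('a)"
    and continuous: "continuous_on UNIV f"
    and open_map: "\<And>S. open S \<Longrightarrow> open (f ` S)"
    and closed_map: "\<And>S. closed S \<Longrightarrow> closed (f ` S)"
    and open_component: "\<And>(S :: 'a set) W. open S \<Longrightarrow> W \<in> components S \<Longrightarrow> open W"
    and closed_C: "closed C" and nowhere_dense_C: "interior C = {}"
    and finite_components_C: "finite (components (- C))"
    and local_multiplicity:
      "\<And>x. \<exists>G. open G \<and> x \<in> G \<and> (\<forall>y. finite (f -` {y} \<inter> G) \<and> card (f -` {y} \<inter> G) \<le> deg x)"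
    and deg_pos: "\<And>x. deg x \<ge> 1"
    and finite_P: "finite P" and deg_outside_P: "\<And>x. x \<notin> P \<Longrightarrow> deg x = 1"
    and nonperiodic: "\<And>x n. x \<in> P \<Longrightarrow> n \<ge> 1 \<Longrightarrow> (f ^^ n) x \<noteq> x"
    and tiles_shrink: "\<And>\<V>. finite_open_cover \<V> \<Longrightarrow> \<exists>m. \<forall>k\<ge>m. \<forall>T\<in>tiles f C k. \<exists>V\<in>\<V>. T \<subseteq> V"
begin

definition open_tiles :: "nat \<Rightarrow> 'a set set" where
  "open_tiles k = components (- (f ^^ k) -` C)"

lemma tiles_eq: "tiles f C k = closure ` open_tiles k"
  by (simp add: tiles_def open_tiles_def Compl_eq_Diff_UNIV)

lemmas continuous_funpow = continuous_on_funpow[OF continuous]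

lemma open_funpow: "open S \<Longrightarrow> open ((f ^^ i) ` S)"
proof (induction i)
  case (Suc i)
  then show ?case unfolding funpow.simps image_comp[symmetric] by (intro open_map)
qed simp

lemma open_complement: "open (- (f ^^ k) -` C)"
  using open_vimage[OF open_Compl[OF closed_C] continuous_funpow, of k] by (simp add: vimage_Compl)

lemma open_open_tile: "W \<in> open_tiles k \<Longrightarrow> open W"
  unfolding open_tiles_def by (rule open_component[OF open_complement])

lemma image_open_tile:
  assumes "W \<in> open_tiles (Suc k)" shows "f ` W \<in> open_tiles k"
  unfolding open_tiles_def
proof (rule open_closed_image_component[OF continuous open_map closed_map], assumption+)
  have "f -` (- (f ^^ k) -` C) = - (f ^^ Suc k) -` C" by (auto simp: funpow_swap1)
  then show "W \<in> components (f -` (- (f ^^ k) -` C))" using assms by (simp add: open_tiles_def)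
qed (rule open_open_tile[OF assms])

lemma funpow_image_open_tile: "W \<in> open_tiles (i + k) \<Longrightarrow> (f ^^ i) ` W \<in> open_tiles k"
proof (induction i arbitrary: k)
  case (Suc i)
  then have "(f ^^ i) ` W \<in> open_tiles (Suc k)" by simp
  from image_open_tile[OF this] show ?case unfolding funpow.simps image_comp[symmetric] .
qed simp

lemma open_tiles_disjoint:
  "W \<in> open_tiles k \<Longrightarrow> W' \<in> open_tiles k \<Longrightarrow> W \<noteq> W' \<Longrightarrow> W \<inter> W' = {}"
  unfolding open_tiles_def by (metis components_nonoverlap)

lemma finite_fibre: "finite (f -` {y})"
proof -
  obtain G where G: "\<And>x. open (G x)" "\<And>x. x \<in> G x" "\<And>x. finite (f -` {y} \<inter> G x)"
    using local_multiplicity by metis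
  obtain X where X: "finite X" "UNIV \<subseteq> (\<Union>x\<in>X. G x)"
  proof (rule compactE_image[OF compact_space, of UNIV G])
    show "UNIV \<subseteq> (\<Union>x\<in>UNIV. G x)" using G(2) by auto
  qed (use G(1) in auto)
  have "f -` {y} \<subseteq> (\<Union>x\<in>X. f -` {y} \<inter> G x)" using X(2) by auto
  then show ?thesis using X(1) G(3) by (meson finite_UN_I finite_subset)
qed

text \<open>
  A tile of level \<open>k + 1\<close> is mapped onto a tile of level \<open>k\<close>, and the tiles over a common image are
  distinguished by the preimages of one point.
\<close>

lemma finite_open_tiles: "finite (open_tiles k)"
proof (induction k)
  case 0
  then show ?case using finite_components_C by (simp add: open_tiles_def)
next
  case (Suc k)
  have "finite {W \<in> open_tiles (Suc k). f ` W = Z}" if "Z \<in> open_tiles k" for Z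
  proof -
    have "Z \<noteq> {}" using in_components_nonempty[OF that[unfolded open_tiles_def]] .
    then obtain p where "p \<in> Z" by auto
    have "finite {W \<in> open_tiles (Suc k). f ` W = Z} \<and>
        card {W \<in> open_tiles (Suc k). f ` W = Z} \<le> card (f -` {p} \<inter> UNIV)"
    proof (rule card_sets_over_common_image[where Z = Z])
      fix W W' assume "W \<in> {W \<in> open_tiles (Suc k). f ` W = Z}" "W' \<in> {W \<in> open_tiles (Suc k). f ` W = Z}" "W \<noteq> W'"
      then show "W \<inter> W' = {}" by (intro open_tiles_disjoint[of W "Suc k" W']) simp_all
    qed (use \<open>p \<in> Z\<close> finite_fibre in simp_all)
    then show ?thesis by simp
  qed
  moreover have "open_tiles (Suc k) \<subseteq> (\<Union>Z\<in>open_tiles k. {W \<in> open_tiles (Suc k). f ` W = Z})"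
    using image_open_tile by blast
  ultimately show ?case using Suc by (meson finite_UN_I finite_subset)
qed

definition followers :: "('a \<Rightarrow> 'a set) \<Rightarrow> nat \<Rightarrow> (nat \<Rightarrow> 'a) \<Rightarrow> 'a set" where
  "followers H n z = {y. \<forall>i<n. (f ^^ i) y \<in> H (z i)}"

text \<open>
  The factor \<open>deg (z 0)\<close> is gained in one step backwards. If two tiles \<open>W\<close>, \<open>W'\<close> meet \<open>H (z 0)\<close>
  then they lie in \<open>G (z 0)\<close>, where \<open>f\<close> has multiplicity at most \<open>deg (z 0)\<close>; so at most that many of
  them have the same image. The images are tiles of the previous level that meet the set of
  points following the shifted word.
\<close>

lemma card_open_tiles_meeting_followers:
  assumes loc: "\<And>x k W. x \<in> X \<Longrightarrow> k \<ge> m \<Longrightarrow> W \<in> open_tiles k \<Longrightarrow> W \<inter> H x \<noteq> {} \<Longrightarrow> W \<subseteq> G x"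
    and mult: "\<And>x y. x \<in> X \<Longrightarrow> card (f -` {y} \<inter> G x) \<le> deg x"
    and z: "\<And>i. i < n \<Longrightarrow> z i \<in> X"
  shows "card {W \<in> open_tiles (n + m). W \<inter> followers H n z \<noteq> {}} \<le> card (open_tiles m) * (\<Prod>i<n. deg (z i))"
  using z
proof (induction n arbitrary: z)
  case 0
  then show ?case by (simp add: card_mono finite_open_tiles)
next
  case (Suc n)
  define z' where "z' i = z (Suc i)" for i
  define S where "S = {Z \<in> open_tiles (n + m). Z \<inter> followers H n z' \<noteq> {}}"
  define R where "R Z = {W \<in> open_tiles (Suc n + m). f ` W = Z \<and> W \<inter> H (z 0) \<noteq> {}}" for Z
  have follow: "followers H (Suc n) z = H (z 0) \<inter> f -` followers H n z'"
    unfolding followers_def z'_def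
    by (auto simp: All_less_Suc2 funpow_swap1)
  have "{W \<in> open_tiles (Suc n + m). W \<inter> followers H (Suc n) z \<noteq> {}} \<subseteq> (\<Union>Z\<in>S. R Z)"
  proof
    fix W assume "W \<in> {W \<in> open_tiles (Suc n + m). W \<inter> followers H (Suc n) z \<noteq> {}}"
    then have W: "W \<in> open_tiles (Suc (n + m))" "W \<inter> followers H (Suc n) z \<noteq> {}" by simp_all
    then have "f ` W \<in> S" using image_open_tile[OF W(1)] follow by (auto simp: S_def)
    moreover have "W \<in> R (f ` W)" using W follow by (auto simp: R_def)
    ultimately show "W \<in> (\<Union>Z\<in>S. R Z)" by blast
  qed
  moreover have fin: "finite S" "finite (R Z)" for Z by (simp_all add: S_def R_def finite_open_tiles)
  ultimately have "card {W \<in> open_tiles (Suc n + m). W \<inter> followers H (Suc n) z \<noteq> {}} \<le> card (\<Union>Z\<in>S. R Z)"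
    by (intro card_mono) auto
  also have "\<dots> \<le> (\<Sum>Z\<in>S. card (R Z))" by (rule card_UN_le[OF fin(1)])
  also have "\<dots> \<le> (\<Sum>Z\<in>S. deg (z 0))"
  proof (rule sum_mono)
    fix Z assume "Z \<in> S"
    then obtain p where p: "p \<in> Z" by (auto simp: S_def)
    have z0: "z 0 \<in> X" using Suc.prems by simp
    have "card (R Z) \<le> card (f -` {p} \<inter> G (z 0))"
    proof (rule card_sets_over_common_image[of _ f Z _ p, THEN conjunct2])
      show "W \<subseteq> G (z 0)" if "W \<in> R Z" for W using that loc[OF z0, of "Suc n + m" W] by (auto simp: R_def)
      show "W \<inter> W' = {}" if "W \<in> R Z" "W' \<in> R Z" "W \<noteq> W'" for W W'
        using that open_tiles_disjoint by (auto simp: R_def)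
      show "f ` W = Z" if "W \<in> R Z" for W using that by (simp add: R_def)
    qed (use p finite_fibre in auto)
    also have "\<dots> \<le> deg (z 0)" by (rule mult[OF z0])
    finally show "card (R Z) \<le> deg (z 0)" .
  qed
  also have "\<dots> = card S * deg (z 0)" by simp
  also have "\<dots> \<le> (card (open_tiles m) * (\<Prod>i<n. deg (z' i))) * deg (z 0)"
    unfolding S_def using Suc.prems by (intro mult_right_mono Suc.IH) (auto simp: z'_def)
  also have "\<dots> = card (open_tiles m) * (\<Prod>i<Suc n. deg (z i))"
    by (simp add: prod.lessThan_Suc_shift z'_def mult_ac del: prod.lessThan_Suc)
  finally show ?case .
qed

text \<open>
  The set of followers is open, and the open tiles of a given level are dense. Since the tiles are
  finite in number, no closure is lost.
\<close>

lemma followers_subset_tiles: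
  assumes "\<And>i. i < n \<Longrightarrow> open (H (z i))"
  shows "followers H n z \<subseteq> \<Union> (closure ` {W \<in> open_tiles k. W \<inter> followers H n z \<noteq> {}})"
proof (rule ccontr)
  let ?\<W> = "{W \<in> open_tiles k. W \<inter> followers H n z \<noteq> {}}"
  define Q where "Q = followers H n z - \<Union> (closure ` ?\<W>)"
  assume "\<not> ?thesis"
  then have "Q \<noteq> {}" by (auto simp: Q_def)
  have "followers H n z = (\<Inter>i<n. (f ^^ i) -` H (z i))" by (auto simp: followers_def)
  then have "open (followers H n z)"
    using assms by (auto intro!: open_INT open_vimage[OF _ continuous_funpow])
  moreover have "closed (\<Union> (closure ` ?\<W>))" using finite_open_tiles by (intro closed_Union) auto
  ultimately have "open Q" unfolding Q_def by (rule open_Diff)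
  have "\<not> (f ^^ k) ` Q \<subseteq> C"
    using open_funpow[OF \<open>open Q\<close>, of k] \<open>Q \<noteq> {}\<close> nowhere_dense_C interior_maximal[of "(f ^^ k) ` Q" C] by auto
  then obtain p where p: "p \<in> Q" "p \<in> - (f ^^ k) -` C" by auto
  then obtain W where W: "W \<in> open_tiles k" "p \<in> W"
    unfolding open_tiles_def using Union_components[of "- (f ^^ k) -` C"] by blast
  then have "W \<in> ?\<W>" using p(1) by (auto simp: Q_def)
  then show False using W(2) p(1) closure_subset unfolding Q_def by blast
qed

lemma nonrecurrent_neighbourhood:
  assumes "c \<in> P"
  shows "\<exists>Q. open Q \<and> c \<in> Q \<and> (\<forall>j. 1 \<le> j \<and> j \<le> N \<longrightarrow> (f ^^ j) ` Q \<inter> Q = {})"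
proof -
  have "\<exists>Q. open Q \<and> c \<in> Q \<and> (f ^^ j) ` Q \<inter> Q = {}" if "j \<in> {1..N}" for j
  proof -
    have "(f ^^ j) c \<noteq> c" using nonperiodic assms that by simp
    then obtain U V where UV: "open U" "open V" "(f ^^ j) c \<in> V" "c \<in> U" "U \<inter> V = {}"
      using hausdorff by metis
    then show ?thesis
      using open_vimage[OF \<open>open V\<close> continuous_funpow, of j]
      by (intro exI[of _ "U \<inter> (f ^^ j) -` V"]) auto
  qed
  then obtain Q where Q: "\<And>j. j \<in> {1..N} \<Longrightarrow> open (Q j) \<and> c \<in> Q j \<and> (f ^^ j) ` Q j \<inter> Q j = {}" by metis
  show ?thesis
  proof (intro exI conjI allI impI)
    show "open (\<Inter>j\<in>{1..N}. Q j)" "c \<in> (\<Inter>j\<in>{1..N}. Q j)" using Q by auto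
    fix j assume "1 \<le> j \<and> j \<le> N"
    then have j: "j \<in> {1..N}" by simp
    have sub: "(\<Inter>j\<in>{1..N}. Q j) \<subseteq> Q j" using j by (rule INT_lower)
    have "(f ^^ j) ` (\<Inter>j\<in>{1..N}. Q j) \<inter> (\<Inter>j\<in>{1..N}. Q j) \<subseteq> (f ^^ j) ` Q j \<inter> Q j"
      by (intro Int_mono image_mono sub)
    then show "(f ^^ j) ` (\<Inter>j\<in>{1..N}. Q j) \<inter> (\<Inter>j\<in>{1..N}. Q j) = {}" using Q[OF j] by simp
  qed
qed

text \<open>
  The closure of \<open>H\<close> is chosen inside \<open>G\<close>. Then \<open>G\<close> and the complement of this closure form an open
  cover, and a tile contained in the second of these sets misses \<open>H\<close>.
\<close>

lemma adapted_neighbourhood: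
  assumes "open B" "x \<in> B"
  shows "\<exists>G H m. open H \<and> x \<in> H \<and> H \<subseteq> B \<and> (\<forall>y. card (f -` {y} \<inter> G) \<le> deg x) \<and>
    (\<forall>k\<ge>m. \<forall>W\<in>open_tiles k. W \<inter> H \<noteq> {} \<longrightarrow> W \<subseteq> G)"
proof -
  obtain G0 where G0: "open G0" "x \<in> G0" "\<And>y. finite (f -` {y} \<inter> G0)" "\<And>y. card (f -` {y} \<inter> G0) \<le> deg x"
    using local_multiplicity by meson
  define G where "G = G0 \<inter> B"
  have G: "open G" "x \<in> G" using G0 assms by (auto simp: G_def)
  have card: "card (f -` {y} \<inter> G) \<le> deg x" for y
  proof -
    have "card (f -` {y} \<inter> G) \<le> card (f -` {y} \<inter> G0)"
      by (rule card_mono[OF G0(3)]) (auto simp: G_def)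
    then show ?thesis using G0(4)[of y] by linarith
  qed
  have "closed (- G)" using G by (simp add: closed_Compl)
  then obtain \<phi> :: "'a \<Rightarrow> real" where \<phi>: "continuous_on UNIV \<phi>" "\<forall>x. 0 \<le> \<phi> x" "- G = {x. \<phi> x = 0}"
    using zero_sets unfolding closed_sets_are_zero_sets_def by blast
  have "\<phi> x \<noteq> 0" using \<phi>(3) G(2) by blast
  then have pos: "\<phi> x > 0" using \<phi>(2) by (metis order.not_eq_order_implies_strict)
  define H where "H = {y. \<phi> x / 2 < \<phi> y}"
  have H: "open H" "x \<in> H" using pos unfolding H_def by (auto intro!: open_Collect_less \<phi> continuous_intros)
  have clH: "closure H \<subseteq> G"
  proof -
    have "closed {y. \<phi> x / 2 \<le> \<phi> y}" by (intro closed_Collect_le \<phi> continuous_intros)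
    then have "closure H \<subseteq> {y. \<phi> x / 2 \<le> \<phi> y}" unfolding H_def by (intro closure_minimal) auto
    also have "\<dots> \<subseteq> G"
    proof
      fix y assume "y \<in> {y. \<phi> x / 2 \<le> \<phi> y}"
      then have "\<phi> y \<noteq> 0" using pos by auto
      then show "y \<in> G" using \<phi>(3) by blast
    qed
    finally show ?thesis .
  qed
  have "finite_open_cover {G, - closure H}"
    using G clH by (auto simp: finite_open_cover_def)
  from tiles_shrink[OF this] obtain m where m: "\<forall>k\<ge>m. \<forall>T\<in>tiles f C k. T \<subseteq> G \<or> T \<subseteq> - closure H" by auto
  have "W \<subseteq> G" if "k \<ge> m" "W \<in> open_tiles k" "W \<inter> H \<noteq> {}" for k W
  proof -
    have "closure W \<subseteq> G \<or> closure W \<subseteq> - closure H" using m that by (auto simp: tiles_eq)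
    then show ?thesis using closure_subset[of W] closure_subset[of H] that(3) by blast
  qed
  moreover have "H \<subseteq> B" using clH closure_subset[of H] by (auto simp: G_def)
  ultimately show ?thesis using H card by blast
qed

text \<open>
  An orbit that follows a word over the neighbourhoods \<open>H x\<close> with \<open>x \<in> X\<close> is near \<open>c \<in> P\<close> at most
  \<open>n div N + 1\<close> times among the first \<open>n\<close> steps, since \<open>Q c\<close> is disjoint from its first \<open>N\<close> images. Hence
  the word contributes at most \<open>card P * (n div N + 1)\<close> factors different from \<open>1\<close>.
\<close>

theorem asymptotically_h_expansive: "asymptotically_h_expansive f"
  unfolding asymptotically_h_expansive_def
proof (intro allI impI)
  fix \<delta> :: real assume "\<delta> > 0"
  define D where "D = Max (insert 1 (deg ` P))"
  have D: "deg c \<le> D" if "c \<in> P" for c unfolding D_def using finite_P that by (intro Max_ge) auto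
  have "D \<ge> 1" unfolding D_def using finite_P by (intro Max_ge) auto
  obtain N0 :: nat where "real (card P) * ln (real D) / \<delta> \<le> real N0" using real_arch_simple by blast
  define N where "N = Suc N0"
  have N: "real (card P) * ln (real D) / real N \<le> \<delta>"
  proof -
    have "real (card P) * ln (real D) \<le> real N0 * \<delta>"
      using \<open>real (card P) * ln (real D) / \<delta> \<le> real N0\<close> \<open>\<delta> > 0\<close> by (simp add: pos_divide_le_eq)
    also have "\<dots> \<le> real N * \<delta>" using \<open>\<delta> > 0\<close> by (simp add: N_def)
    finally show ?thesis by (simp add: N_def field_simps)
  qed
  have "\<exists>Q. open Q \<and> x \<in> Q \<and> (x \<in> P \<longrightarrow> (\<forall>j. 1 \<le> j \<and> j \<le> N \<longrightarrow> (f ^^ j) ` Q \<inter> Q = {}))" for x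
    using nonrecurrent_neighbourhood[of x N] open_UNIV UNIV_I by (cases "x \<in> P") blast+
  then obtain Q where Q: "\<And>x. open (Q x)" "\<And>x. x \<in> Q x"
      "\<And>x j. x \<in> P \<Longrightarrow> 1 \<le> j \<Longrightarrow> j \<le> N \<Longrightarrow> (f ^^ j) ` Q x \<inter> Q x = {}" by metis
  have "\<forall>x. \<exists>G H m. open H \<and> x \<in> H \<and> H \<subseteq> Q x \<and> (\<forall>y. card (f -` {y} \<inter> G) \<le> deg x) \<and>
    (\<forall>k\<ge>m. \<forall>W\<in>open_tiles k. W \<inter> H \<noteq> {} \<longrightarrow> W \<subseteq> G)"
    using adapted_neighbourhood Q by blast
  then obtain G H m where H: "\<And>x. open (H x)" "\<And>x. x \<in> H x" "\<And>x. H x \<subseteq> Q x"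
    and G: "\<And>x y. card (f -` {y} \<inter> G x) \<le> deg x"
    and m: "\<And>x k W. k \<ge> m x \<Longrightarrow> W \<in> open_tiles k \<Longrightarrow> W \<inter> H x \<noteq> {} \<Longrightarrow> W \<subseteq> G x"
    by metis
  obtain X where X: "finite X" "UNIV \<subseteq> (\<Union>x\<in>X. H x)"
  proof (rule compactE_image[OF compact_space, of UNIV H])
    show "UNIV \<subseteq> (\<Union>x\<in>UNIV. H x)" using H(2) by auto
  qed (use H(1) in auto)
  have cover: "finite_open_cover (H ` X)" using X H(1) unfolding finite_open_cover_def by blast
  have "conditional_entropy_at_most f (H ` X) \<delta>"
    unfolding conditional_entropy_at_most_def
  proof (intro allI impI)
    fix \<V> :: "'a set set" assume "finite_open_cover \<V>"
    obtain m1 where m1: "\<And>k T. k \<ge> m1 \<Longrightarrow> T \<in> tiles f C k \<Longrightarrow> \<exists>V\<in>\<V>. T \<subseteq> V"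
      using tiles_shrink[OF \<open>finite_open_cover \<V>\<close>] by (elim exE) (rule that, blast)
    define M where "M = Max (insert m1 (m ` X))"
    have M: "M \<ge> m1" "\<And>x. x \<in> X \<Longrightarrow> M \<ge> m x" unfolding M_def using X(1) by (auto intro!: Max_ge)
    (* The power of D absorbs the additional visit that each point of P may receive. *)
    define K where "K = real (card (open_tiles M)) * real D ^ card P"
    show "\<exists>K. \<forall>n s. (\<forall>i<n. s i \<in> H ` X) \<longrightarrow>
        (\<exists>\<E>. finite \<E> \<and> real (card \<E>) \<le> K * exp (\<delta> * real n) \<and>
           {y. \<forall>i<n. (f ^^ i) y \<in> s i} \<subseteq> \<Union> \<E> \<and> (\<forall>E\<in>\<E>. \<forall>i<n. \<exists>V\<in>\<V>. (f ^^ i) ` E \<subseteq> V))"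
    proof (intro exI[of _ K] allI impI)
      fix n and s :: "nat \<Rightarrow> 'a set" assume "\<forall>i<n. s i \<in> H ` X"
      then have "\<forall>i. \<exists>x. i < n \<longrightarrow> x \<in> X \<and> s i = H x" by auto
      from choice[OF this] obtain z where z: "\<And>i. i < n \<Longrightarrow> z i \<in> X \<and> s i = H (z i)" by auto
      have A: "{y. \<forall>i<n. (f ^^ i) y \<in> s i} = followers H n z" using z by (auto simp: followers_def)
      let ?\<W> = "{W \<in> open_tiles (n + M). W \<inter> followers H n z \<noteq> {}}"
      have card: "real (card ?\<W>) \<le> K * exp (\<delta> * real n)"
      proof (cases "followers H n z = {}")
        case True
        then show ?thesis by (simp add: K_def)
      next
        case False
        then obtain y where y: "\<And>i. i < n \<Longrightarrow> (f ^^ i) y \<in> H (z i)" by (auto simp: followers_def)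
        define J where "J c = {i. i < n \<and> z i = c}" for c
        have J: "card (J c) \<le> Suc (n div N)" if "c \<in> P" for c
        proof (rule card_sparse_le)
          show "J c \<subseteq> {..<n}" by (auto simp: J_def)
          show "N \<ge> 1" by (simp add: N_def)
          fix i j assume ij: "i \<in> J c" "j \<in> J c" "i < j"
          have "(f ^^ i) y \<in> Q c" "(f ^^ j) y \<in> Q c" 
            using ij y[of i] y[of j] H(3)[of c] by (auto simp: J_def)
          moreover have "(f ^^ j) y = (f ^^ (j - i)) ((f ^^ i) y)"
            using ij(3) by (simp add: funpow_add[symmetric, THEN fun_cong, unfolded comp_apply])
          ultimately have "(f ^^ (j - i)) ` Q c \<inter> Q c \<noteq> {}" by blast
          then show "N < j - i" using Q(3)[OF \<open>c \<in> P\<close>, of "j - i"] ij(3) by force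
        qed
        have "(\<Prod>i<n. deg (z i)) = (\<Prod>i\<in>(\<Union>c\<in>P. J c). deg (z i))"
          by (rule prod.mono_neutral_right) (auto simp: J_def deg_outside_P)
        also have "\<dots> \<le> (\<Prod>i\<in>(\<Union>c\<in>P. J c). D)" by (rule prod_mono) (auto simp: J_def D)
        also have "\<dots> = D ^ card (\<Union>c\<in>P. J c)" by simp
        also have "\<dots> \<le> D ^ (card P * Suc (n div N))"
        proof (rule power_increasing[OF _ \<open>D \<ge> 1\<close>])
          have "card (\<Union>c\<in>P. J c) \<le> (\<Sum>c\<in>P. card (J c))" by (rule card_UN_le[OF finite_P])
          also have "\<dots> \<le> (\<Sum>c\<in>P. Suc (n div N))" by (rule sum_mono) (rule J)
          finally show "card (\<Union>c\<in>P. J c) \<le> card P * Suc (n div N)" by simp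
        qed
        finally have prod: "(\<Prod>i<n. deg (z i)) \<le> D ^ (card P * Suc (n div N))" .
        have "card ?\<W> \<le> card (open_tiles M) * (\<Prod>i<n. deg (z i))"
        proof (rule card_open_tiles_meeting_followers[where X = X and G = G])
          show "W \<subseteq> G x" if "x \<in> X" "M \<le> k" "W \<in> open_tiles k" "W \<inter> H x \<noteq> {}" for x k W
            using m[of x k W] M(2)[of x] that by (meson le_trans)
        qed (use G z in simp_all)
        also have "\<dots> \<le> card (open_tiles M) * D ^ (card P * Suc (n div N))" using prod by simp
        finally have "real (card ?\<W>) \<le> real (card (open_tiles M) * D ^ (card P * Suc (n div N)))"
          by (rule of_nat_mono)
        also have "\<dots> = K * real D ^ (card P * (n div N))" by (simp add: K_def power_add)
        also have "real D ^ (card P * (n div N)) \<le> exp (\<delta> * real n)"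
        proof -
          have "real D ^ (card P * (n div N)) = exp (real (card P * (n div N)) * ln (real D))"
            using \<open>D \<ge> 1\<close> by (subst exp_of_nat_mult) simp
          also have "\<dots> \<le> exp (\<delta> * real n)"
          proof -
            have "real (n div N) * real N \<le> real n"
              by (metis div_times_less_eq_dividend of_nat_le_iff of_nat_mult)
            then have "real (n div N) \<le> real n / real N" by (simp add: pos_le_divide_eq N_def)
            then have "real (n div N) * (real (card P) * ln (real D)) \<le> real n / real N * (real (card P) * ln (real D))"
              using \<open>D \<ge> 1\<close> by (intro mult_right_mono) auto
            also have "\<dots> = real n * (real (card P) * ln (real D) / real N)" by simp
            also have "\<dots> \<le> real n * \<delta>" using N by (intro mult_left_mono) auto
            finally show ?thesis by (simp add: mult_ac)
          qed
          finally show ?thesis .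
        qed
        finally show ?thesis by (simp add: K_def mult_left_mono)
      qed
      show "\<exists>\<E>. finite \<E> \<and> real (card \<E>) \<le> K * exp (\<delta> * real n) \<and>
           {y. \<forall>i<n. (f ^^ i) y \<in> s i} \<subseteq> \<Union> \<E> \<and> (\<forall>E\<in>\<E>. \<forall>i<n. \<exists>V\<in>\<V>. (f ^^ i) ` E \<subseteq> V)"
      proof (intro exI[of _ "closure ` ?\<W>"] conjI ballI allI impI)
        show fin: "finite (closure ` ?\<W>)" using finite_open_tiles by simp
        have "card (closure ` ?\<W>) \<le> card ?\<W>" using finite_open_tiles by (intro card_image_le) simp
        then show "real (card (closure ` ?\<W>)) \<le> K * exp (\<delta> * real n)" using card by linarith
        show "{y. \<forall>i<n. (f ^^ i) y \<in> s i} \<subseteq> \<Union> (closure ` ?\<W>)"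
          unfolding A by (rule followers_subset_tiles) (rule H(1))
        fix E i assume "E \<in> closure ` ?\<W>" "i < n"
        then obtain W where W: "W \<in> open_tiles (i + (n - i + M))" "E = closure W" by auto
        have "closure ((f ^^ i) ` W) \<in> tiles f C (n - i + M)"
          using funpow_image_open_tile[OF W(1)] by (simp add: tiles_eq)
        then obtain V where V: "V \<in> \<V>" "closure ((f ^^ i) ` W) \<subseteq> V"
          using m1[of "n - i + M"] M(1) by (meson le_trans le_add2)
        have "(f ^^ i) ` E \<subseteq> closure ((f ^^ i) ` W)"
          unfolding W(2) by (intro image_closure_subset continuous_on_subset[OF continuous_funpow] closed_closure closure_subset) auto
        then show "\<exists>V\<in>\<V>. (f ^^ i) ` E \<subseteq> V" using V by blast
      qed
    qed
  qed
  then show "\<exists>\<U>. finite_open_cover \<U> \<and> conditional_entropy_at_most f \<U> \<delta>" using cover by blast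
qed

end

section \<open>Local degrees\<close>

lemma openin_riemann_sphere_Some:
  assumes "openin riemann_sphere U" shows "open (Some -` U)"
proof -
  have "openin euclidean {x \<in> topspace euclidean. Some x \<in> U}"
    using assms continuous_map_Some[of "euclidean :: complex topology"]
    unfolding riemann_sphere_def continuous_map_def by blast
  then show ?thesis by (simp add: vimage_def)
qed

lemma openin_riemann_sphere_image_Some: "open S \<Longrightarrow> openin riemann_sphere (Some ` S)"
  by (simp add: riemann_sphere_def)

text \<open>
  The normal form in complex coordinates. The neighbourhoods on the Riemann sphere in the
  definition of the local degree may contain the point at infinity, where \<open>z \<mapsto> z\<^sup>d\<close> is again
  branched; the chart is therefore cut down to a disc.
\<close>

lemma local_power_chart:
  assumes "has_local_degree \<omega> f x d"
  obtains r U and a :: "'a::topological_space \<Rightarrow> complex"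
    where "r > 0" "d \<ge> 1" "open U" "x \<in> U" "inj_on a U" "a ` U = ball 0 r" "a x = 0"
      "\<And>S. open S \<Longrightarrow> open (U \<inter> a -` S)"
      "\<And>y z. y \<in> U \<Longrightarrow> z \<in> U \<Longrightarrow> f y = f z \<longleftrightarrow> a y ^ d = a z ^ d"
      "\<And>s. 0 < s \<Longrightarrow> s \<le> r \<Longrightarrow> open (f ` (U \<inter> a -` ball 0 s))"
      "\<And>B. open B \<Longrightarrow> x \<in> B \<Longrightarrow> \<exists>s. 0 < s \<and> s \<le> r \<and> U \<inter> a -` ball 0 s \<subseteq> B"
proof -
  from assms have d: "d \<ge> 1" by (simp add: has_local_degree_def)
  from assms[unfolded has_local_degree_def, THEN conjunct2] obtain U V U' V' \<phi> \<eta> where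
    chart: "open U \<and> x \<in> U \<and> open V \<and> f x \<in> V \<and> f ` U \<subseteq> V \<and>
        openin riemann_sphere U' \<and> Some 0 \<in> U' \<and>
        openin riemann_sphere V' \<and> Some 0 \<in> V' \<and>
        orientation_preserving_homeomorphism euclidean \<omega> U riemann_sphere rs_orientation U' \<phi> \<and>
        orientation_preserving_homeomorphism euclidean \<omega> V riemann_sphere rs_orientation V' \<eta> \<and>
        \<phi> x = Some 0 \<and> \<eta> (f x) = Some 0 \<and>
        (\<forall>z\<in>U'. (\<eta> \<circ> f \<circ> inv_into U \<phi>) z = rs_power d z)"
    by (elim exE) (rule that)
  have U: "open U" "x \<in> U" and V: "open V" "f x \<in> V" "f ` U \<subseteq> V"
    and U': "openin riemann_sphere U'" "Some 0 \<in> U'"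
    and \<phi>: "homeomorphic_map (subtopology euclidean U) (subtopology riemann_sphere U') \<phi>"
    and \<eta>: "homeomorphic_map (subtopology euclidean V) (subtopology riemann_sphere V') \<eta>"
    and \<phi>x: "\<phi> x = Some 0" and power: "\<forall>z\<in>U'. (\<eta> \<circ> f \<circ> inv_into U \<phi>) z = rs_power d z"
    using chart by (simp_all add: orientation_preserving_homeomorphism_def)
  have top: "topspace riemann_sphere = UNIV"
    by (simp add: riemann_sphere_def UNIV_option_conv)
  have inj\<phi>: "inj_on \<phi> U" and img\<phi>: "\<phi> ` U = U'"
    using homeomorphic_imp_injective_map[OF \<phi>] homeomorphic_imp_surjective_map[OF \<phi>] by (simp_all add: top)
  have inj\<eta>: "inj_on \<eta> V"
    using homeomorphic_imp_injective_map[OF \<eta>] by (simp add: top)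
  have pre: "open (A \<inter> \<psi> -` S)"
    if "open A" and \<psi>: "homeomorphic_map (subtopology euclidean A) (subtopology riemann_sphere A') \<psi>"
      and S: "openin riemann_sphere S" for A A' S and \<psi> :: "'a \<Rightarrow> complex option"
  proof -
    have c: "continuous_map (subtopology euclidean A) (subtopology riemann_sphere A') \<psi>"
      using \<psi> by (rule homeomorphic_imp_continuous_map)
    then have "continuous_map (subtopology euclidean A) riemann_sphere \<psi>"
      by (simp add: continuous_map_in_subtopology)
    then have "openin (subtopology euclidean A) {x \<in> topspace (subtopology euclidean A). \<psi> x \<in> S}"
      using S by (rule openin_continuous_map_preimage)
    moreover have "{x \<in> topspace (subtopology euclidean A). \<psi> x \<in> S} = A \<inter> \<psi> -` S" by auto
    ultimately show ?thesis using \<open>open A\<close> by (simp add: openin_open_eq)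
  qed
  obtain r where r: "r > 0" "ball 0 r \<subseteq> Some -` U'"
    using openin_riemann_sphere_Some[OF U'(1)] U'(2) by (auto elim: openE)
  define U0 where "U0 = U \<inter> \<phi> -` (Some ` ball 0 r)"
  define a where "a y = the (\<phi> y)" for y
  have Some_a: "\<phi> y = Some (a y)" if "y \<in> U0" for y using that by (auto simp: U0_def a_def)
  have eta_f: "\<eta> (f y) = Some (a y ^ d)" if "y \<in> U0" for y
  proof -
    have "y \<in> U" using that by (simp add: U0_def)
    then have "\<eta> (f y) = rs_power d (\<phi> y)"
      using power img\<phi> inv_into_f_f[OF inj\<phi>] by force
    then show ?thesis by (simp add: Some_a[OF that] rs_power_def)
  qed
  have U0a: "U0 \<inter> a -` S = U \<inter> \<phi> -` (Some ` (ball 0 r \<inter> S))" for S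
    by (auto simp: U0_def a_def)
  have fV: "f y \<in> V" if "y \<in> U0" for y using that V(3) by (auto simp: U0_def)
  show ?thesis
  proof (rule that[OF r(1) d])
    show "open U0"
      unfolding U0_def by (rule pre[OF U(1) \<phi>]) (simp add: openin_riemann_sphere_image_Some)
    show "x \<in> U0" using U(2) \<phi>x r(1) by (auto simp: U0_def)
    show "inj_on a U0"
      by (rule inj_onI) (metis Some_a inj\<phi> inj_onD U0_def IntD1)
    show "a ` U0 = ball 0 r"
    proof
      show "a ` U0 \<subseteq> ball 0 r" by (auto simp: U0_def a_def)
      show "ball 0 r \<subseteq> a ` U0"
      proof
        fix z :: complex assume z: "z \<in> ball 0 r"
        then have "Some z \<in> \<phi> ` U" using r(2) img\<phi> by auto
        then obtain y where "y \<in> U" "\<phi> y = Some z" by force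
        then have "y \<in> U0" "a y = z" using z by (auto simp: U0_def a_def)
        then show "z \<in> a ` U0" by blast
      qed
    qed
    show "a x = 0" by (simp add: a_def \<phi>x)
    show "open (U0 \<inter> a -` S)" if "open S" for S
      unfolding U0a using that by (intro pre[OF U(1) \<phi>] openin_riemann_sphere_image_Some) auto
    show "f y = f z \<longleftrightarrow> a y ^ d = a z ^ d" if "y \<in> U0" "z \<in> U0" for y z
      using eta_f[OF that(1)] eta_f[OF that(2)] inj_onD[OF inj\<eta>, of "f y" "f z"] fV that by auto
    show "open (f ` (U0 \<inter> a -` ball 0 s))" if s: "0 < s" "s \<le> r" for s
    proof -
      have "f ` (U0 \<inter> a -` ball 0 s) = V \<inter> \<eta> -` (Some ` ball 0 (s ^ d))"
      proof (intro equalityI subsetI)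
        fix v assume "v \<in> f ` (U0 \<inter> a -` ball 0 s)"
        then obtain y where y: "y \<in> U0" "norm (a y) < s" "v = f y" by auto
        then have "norm (a y ^ d) < s ^ d" using d by (simp add: norm_power power_strict_mono)
        then show "v \<in> V \<inter> \<eta> -` (Some ` ball 0 (s ^ d))" using y fV eta_f by auto
      next
        fix v assume "v \<in> V \<inter> \<eta> -` (Some ` ball 0 (s ^ d))"
        then obtain w where w: "v \<in> V" "\<eta> v = Some w" "norm w < s ^ d" by auto
        obtain z where z: "w = z ^ d" using exists_complex_root[of d w] d by auto
        have "norm z < s"
          using w(3) s z by (intro power_less_imp_less_base[of "norm z" d s]) (auto simp: norm_power)
        then have "z \<in> ball 0 r" using s by simp
        then have "Some z \<in> \<phi> ` U" using r(2) img\<phi> by auto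
        then obtain y where "y \<in> U" "\<phi> y = Some z" by force
        then have y: "y \<in> U0" "a y = z" using \<open>z \<in> ball 0 r\<close> by (auto simp: U0_def a_def)
        then have "\<eta> (f y) = \<eta> v" using eta_f w z by simp
        then have "f y = v" using inj_onD[OF inj\<eta>] fV[OF y(1)] w(1) by blast
        then show "v \<in> f ` (U0 \<inter> a -` ball 0 s)" using y \<open>norm z < s\<close> by auto
      qed
      moreover have "open (V \<inter> \<eta> -` (Some ` ball 0 (s ^ d)))"
        by (intro pre[OF V(1) \<eta>] openin_riemann_sphere_image_Some) auto
      ultimately show ?thesis by simp
    qed
    show "\<exists>s. 0 < s \<and> s \<le> r \<and> U0 \<inter> a -` ball 0 s \<subseteq> B" if B: "open B" "x \<in> B" for B
    proof -
      have "openin (subtopology euclidean U) (B \<inter> U)" using B(1) by (auto simp: openin_open)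
      then have "openin (subtopology riemann_sphere U') (\<phi> ` (B \<inter> U))"
        using homeomorphic_map_openness[OF \<phi>, of "B \<inter> U"] by simp
      then have "openin riemann_sphere (\<phi> ` (B \<inter> U))"
        using U'(1) by (meson openin_trans_full)
      then have "open (Some -` (\<phi> ` (B \<inter> U)))" by (rule openin_riemann_sphere_Some)
      moreover have "0 \<in> Some -` (\<phi> ` (B \<inter> U))" using B(2) U(2) \<phi>x by force
      ultimately obtain s0 where s0: "s0 > 0" "ball 0 s0 \<subseteq> Some -` (\<phi> ` (B \<inter> U))" by (rule openE)
      have "U0 \<inter> a -` ball 0 (min s0 r) \<subseteq> B"
      proof
        fix y assume y: "y \<in> U0 \<inter> a -` ball 0 (min s0 r)"
        then have "\<phi> y \<in> \<phi> ` (B \<inter> U)" using s0(2) Some_a[of y] by auto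
        then obtain y' where "y' \<in> B" "y' \<in> U" "\<phi> y = \<phi> y'" by blast
        then show "y \<in> B" using y inj_onD[OF inj\<phi>, of y y'] by (auto simp: U0_def)
      qed
      then show ?thesis using s0(1) r(1) by (intro exI[of _ "min s0 r"]) auto
    qed
  qed
qed

lemma card_power_fibre_le: "d \<ge> 1 \<Longrightarrow> finite {z :: complex. z ^ d = c} \<and> card {z :: complex. z ^ d = c} \<le> d"
proof (cases "c = 0")
  case True
  assume "d \<ge> 1"
  then have "{z :: complex. z ^ d = c} = {0}" using True by auto
  then show ?thesis using \<open>d \<ge> 1\<close> by simp
qed (simp add: card_nth_roots finite_nth_roots)

lemma has_local_degree_multiplicity_le:
  assumes "has_local_degree \<omega> f x d"
  shows "\<exists>U. open U \<and> x \<in> U \<and> (\<forall>y. finite (f -` {y} \<inter> U) \<and> card (f -` {y} \<inter> U) \<le> d)"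
proof -
  obtain r U and a :: "'a \<Rightarrow> complex" where c: "d \<ge> 1" "open U" "x \<in> U" "inj_on a U"
      "\<And>y z. y \<in> U \<Longrightarrow> z \<in> U \<Longrightarrow> f y = f z \<longleftrightarrow> a y ^ d = a z ^ d"
    using local_power_chart[OF assms] by metis
  have "finite (f -` {y} \<inter> U) \<and> card (f -` {y} \<inter> U) \<le> d" for y
  proof (cases "f -` {y} \<inter> U = {}")
    case False
    then obtain u where u: "u \<in> U" "f u = y" by auto
    have sub: "a ` (f -` {y} \<inter> U) \<subseteq> {z. z ^ d = a u ^ d}" using c(5) u by auto
    note fin = card_power_fibre_le[OF c(1), of "a u ^ d"]
    have inj: "inj_on a (f -` {y} \<inter> U)" using c(4) by (rule inj_on_subset) auto
    have "finite (f -` {y} \<inter> U)" using finite_imageD[OF _ inj] finite_subset[OF sub] fin by blast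
    moreover have "card (f -` {y} \<inter> U) \<le> card {z. z ^ d = a u ^ d}"
      using card_inj_on_le[OF inj sub] fin by blast
    ultimately show ?thesis using fin by linarith
  qed simp
  then show ?thesis using c by blast
qed

text \<open>
  The \<open>d\<close>-th roots of a small nonzero number lie in the chart and are the coordinates of \<open>d\<close> points with
  the same image. Together with the upper bound on the multiplicity this makes the local degree
  unique.
\<close>

lemma has_local_degree_multiplicity_attained:
  assumes "has_local_degree \<omega> f x d" "open B" "x \<in> B"
  shows "\<exists>E\<subseteq>B. finite E \<and> card E = d \<and> (\<forall>y\<in>E. \<forall>z\<in>E. f y = f z)"
proof -
  obtain r U and a :: "'a \<Rightarrow> complex" where c: "d \<ge> 1" "inj_on a U" "a ` U = ball 0 r"
      "\<And>y z. y \<in> U \<Longrightarrow> z \<in> U \<Longrightarrow> f y = f z \<longleftrightarrow> a y ^ d = a z ^ d"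
      "\<exists>s. 0 < s \<and> s \<le> r \<and> U \<inter> a -` ball 0 s \<subseteq> B"
    using local_power_chart[OF assms(1)] assms(2,3) by metis
  then obtain s where s: "0 < s" "s \<le> r" "U \<inter> a -` ball 0 s \<subseteq> B" by blast
  define w where "w = complex_of_real (s / 2) ^ d"
  define Z where "Z = {z. z ^ d = w}"
  have "w \<noteq> 0" using s by (simp add: w_def)
  then have Z: "card Z = d" "finite Z" unfolding Z_def using c(1) by (auto simp: card_nth_roots finite_nth_roots)
  have Zs: "norm z < s" if "z \<in> Z" for z
  proof -
    have "norm z ^ d = (s / 2) ^ d"
      using that s by (metis (mono_tags) Z_def mem_Collect_eq norm_power norm_of_real w_def abs_of_pos half_gt_zero)
    then have "norm z = s / 2" using c(1) s by (intro power_eq_imp_eq_base[of "norm z" d "s / 2"]) auto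
    then show ?thesis using s by simp
  qed
  define E where "E = U \<inter> a -` Z"
  have "a ` E = Z"
  proof
    show "Z \<subseteq> a ` E"
    proof
      fix z assume "z \<in> Z"
      then have "z \<in> a ` U" using Zs s c(3) by force
      then show "z \<in> a ` E" using \<open>z \<in> Z\<close> by (auto simp: E_def)
    qed
  qed (auto simp: E_def)
  moreover have inj: "inj_on a E" using c(2) by (rule inj_on_subset) (auto simp: E_def)
  ultimately have "finite E" "card E = d" using Z finite_imageD[OF _ inj] card_image[OF inj] by auto
  moreover have "E \<subseteq> B" using Zs s(3) by (auto simp: E_def)
  moreover have "f y = f z" if "y \<in> E" "z \<in> E" for y z
    using that c(4)[of y z] by (auto simp: E_def Z_def)
  ultimately show ?thesis by blast
qed

lemma has_local_degree_unique:
  assumes "has_local_degree \<omega> f x d" "has_local_degree \<omega> f x d'" shows "d = d'"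
proof -
  have le: "d \<le> d'" if d: "has_local_degree \<omega> f x d" and d': "has_local_degree \<omega> f x d'" for d d'
  proof -
    obtain U where U: "open U" "x \<in> U" "\<And>y. finite (f -` {y} \<inter> U)" "\<And>y. card (f -` {y} \<inter> U) \<le> d'"
      using has_local_degree_multiplicity_le[OF d'] by blast
    obtain E where E: "E \<subseteq> U" "finite E" "card E = d" "\<forall>y\<in>E. \<forall>z\<in>E. f y = f z"
      using has_local_degree_multiplicity_attained[OF d U(1,2)] by blast
    show ?thesis
    proof (cases "E = {}")
      case False
      then obtain y where "y \<in> E" by blast
      then have "E \<subseteq> f -` {f y} \<inter> U" using E by blast
      then have "card E \<le> card (f -` {f y} \<inter> U)" using U(3) by (intro card_mono)
      then show ?thesis using E(3) U(4)[of "f y"] by linarith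
    qed (use E in simp)
  qed
  show ?thesis using le[OF assms] le[OF assms(2,1)] by simp
qed

text \<open>
  Since \<open>z \<mapsto> z\<^sup>d\<close> is injective near every nonzero point, \<open>f\<close> is injective near every point of the chart
  other than \<open>x\<close>, whereas local degree at least \<open>2\<close> forces two points with the same image in every
  neighbourhood.
\<close>

lemma has_local_degree_isolated:
  assumes "has_local_degree \<omega> f x d"
  shows "\<exists>U. open U \<and> x \<in> U \<and> (\<forall>y\<in>U. \<forall>e. has_local_degree \<omega> f y e \<longrightarrow> y \<noteq> x \<longrightarrow> e < 2)"
proof -
  obtain r U and a :: "'a \<Rightarrow> complex" where c: "d \<ge> 1" "open U" "x \<in> U" "inj_on a U" "a x = 0"
      "\<And>S. open S \<Longrightarrow> open (U \<inter> a -` S)"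
      "\<And>y z. y \<in> U \<Longrightarrow> z \<in> U \<Longrightarrow> f y = f z \<longleftrightarrow> a y ^ d = a z ^ d"
    using local_power_chart[OF assms] by metis
  have "e < 2" if y: "y \<in> U" "y \<noteq> x" and e: "has_local_degree \<omega> f y e" for y e
  proof (rule ccontr)
    assume "\<not> e < 2"
    have ay: "a y \<noteq> 0" using y c by (metis inj_onD)
    have dnz: "deriv (\<lambda>z. z ^ d) (a y) \<noteq> 0"
    proof -
      have "((\<lambda>z. z ^ d) has_field_derivative of_nat d * a y ^ (d - 1)) (at (a y))"
        by (auto intro!: derivative_eq_intros)
      then have "deriv (\<lambda>z. z ^ d) (a y) = of_nat d * a y ^ (d - 1)" by (rule DERIV_imp_deriv)
      then show ?thesis using ay c(1) by simp
    qed
    obtain \<rho> where \<rho>: "\<rho> > 0" "inj_on (\<lambda>z. z ^ d) (ball (a y) \<rho>)"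
      by (rule has_complex_derivative_locally_injective[of "\<lambda>z. z ^ d" UNIV "a y"])
         (use dnz in \<open>auto intro!: holomorphic_intros\<close>)
    define B where "B = U \<inter> a -` ball (a y) \<rho>"
    have B: "open B" "y \<in> B" using c(6)[of "ball (a y) \<rho>"] y \<rho> by (auto simp: B_def)
    obtain E where E: "E \<subseteq> B" "finite E" "card E = e" "\<forall>y\<in>E. \<forall>z\<in>E. f y = f z"
      using has_local_degree_multiplicity_attained[OF e B] by blast
    have "u = v" if "u \<in> E" "v \<in> E" for u v
    proof -
      have uv: "u \<in> U" "v \<in> U" "a u \<in> ball (a y) \<rho>" "a v \<in> ball (a y) \<rho>" using that E(1) by (auto simp: B_def)
      have "a u ^ d = a v ^ d" using c(7)[OF uv(1,2)] E(4) that by blast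
      then have "a u = a v" using inj_onD[OF \<rho>(2)] uv by blast
      then show ?thesis using inj_onD[OF c(4)] uv by blast
    qed
    then have "card E \<le> 1" using E(2) by (metis card_le_Suc0_iff_eq One_nat_def)
    then show False using E(3) \<open>\<not> e < 2\<close> by simp
  qed
  then show ?thesis using c by blast
qed

lemma has_local_degree_open_at:
  assumes "has_local_degree \<omega> f x d" "open B" "x \<in> B"
  shows "\<exists>T. open T \<and> f x \<in> T \<and> T \<subseteq> f ` B"
proof -
  obtain r U and a :: "'a \<Rightarrow> complex" where c: "x \<in> U" "a x = 0"
      "\<And>s. 0 < s \<Longrightarrow> s \<le> r \<Longrightarrow> open (f ` (U \<inter> a -` ball 0 s))"
      "\<exists>s. 0 < s \<and> s \<le> r \<and> U \<inter> a -` ball 0 s \<subseteq> B"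
    using local_power_chart[OF assms(1)] assms(2,3) by metis
  then obtain s where s: "0 < s" "s \<le> r" "U \<inter> a -` ball 0 s \<subseteq> B" by blast
  then have "f x \<in> f ` (U \<inter> a -` ball 0 s)" using c(1,2) by auto
  moreover have "f ` (U \<inter> a -` ball 0 s) \<subseteq> f ` B" using s(3) by (rule image_mono)
  ultimately show ?thesis using c(3)[OF s(1,2)] by blast
qed

lemma local_degree_eq: "has_local_degree \<omega> f x d \<Longrightarrow> local_degree \<omega> f x = d"
  unfolding local_degree_def using has_local_degree_unique by blast

lemma branched_covering_has_local_degree:
  "branched_covering \<omega> f \<Longrightarrow> has_local_degree \<omega> f x (local_degree \<omega> f x)"
  unfolding branched_covering_def using local_degree_eq by metis

lemma branched_covering_open_map:
  assumes f: "branched_covering \<omega> f" and B: "open B" shows "open (f ` B)"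
proof -
  have "\<exists>T. open T \<and> v \<in> T \<and> T \<subseteq> f ` B" if "v \<in> f ` B" for v
    using that has_local_degree_open_at[OF branched_covering_has_local_degree[OF f] B] by auto
  then show ?thesis by (subst open_subopen) blast
qed

lemma finite_crit:
  fixes f :: "'a::topological_space \<Rightarrow> 'a"
  assumes cpt: "compact (UNIV :: 'a set)" and f: "branched_covering \<omega> f"
  shows "finite (crit \<omega> f)"
proof -
  have "\<forall>x. \<exists>U. open U \<and> x \<in> U \<and> crit \<omega> f \<inter> U \<subseteq> {x}"
  proof
    fix x
    obtain U where U: "open U" "x \<in> U" "\<forall>y\<in>U. \<forall>e. has_local_degree \<omega> f y e \<longrightarrow> y \<noteq> x \<longrightarrow> e < 2"
      using has_local_degree_isolated[OF branched_covering_has_local_degree[OF f]] by blast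
    have "crit \<omega> f \<inter> U \<subseteq> {x}"
    proof
      fix y assume y: "y \<in> crit \<omega> f \<inter> U"
      then have "\<not> local_degree \<omega> f y < 2" by (simp add: crit_def)
      then show "y \<in> {x}" using U(3) y branched_covering_has_local_degree[OF f, of y] by blast
    qed
    then show "\<exists>U. open U \<and> x \<in> U \<and> crit \<omega> f \<inter> U \<subseteq> {x}" using U by blast
  qed
  then obtain U where U: "\<And>x. open (U x)" "\<And>x. x \<in> U x" "\<And>x. crit \<omega> f \<inter> U x \<subseteq> {x}" by metis
  obtain X where X: "finite X" "UNIV \<subseteq> (\<Union>x\<in>X. U x)"
  proof (rule compactE_image[OF cpt, of UNIV U])
    show "UNIV \<subseteq> (\<Union>x\<in>UNIV. U x)" using U(2) by auto
  qed (use U(1) in auto)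
  have "crit \<omega> f \<subseteq> X"
  proof
    fix y assume y: "y \<in> crit \<omega> f"
    obtain x where "x \<in> X" "y \<in> U x" using X(2) by auto
    then show "y \<in> X" using U(3)[of x] y by auto
  qed
  then show ?thesis using X(1) by (rule finite_subset)
qed

section \<open>Topology of the sphere\<close>

text \<open>
  The topological facts about spheres are available for unit spheres of Euclidean spaces; a chart
  onto one of them transports them to the abstract sphere.
\<close>

lemma oriented_2_sphere_homeomorphism:
  assumes "oriented_2_sphere (euclidean :: 'a::topological_space topology) \<omega>"
  shows "\<exists>h g. homeomorphism (UNIV :: 'a set) (sphere (0 :: real^3) 1) h g"
proof -
  obtain f :: "(nat \<Rightarrow> real) \<Rightarrow> real^3" and g where
    "homeomorphic_maps (nsphere (3 - 1)) (top_of_set (sphere 0 1 \<inter> span (Basis :: (real^3) set))) f g"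
    by (rule homeomorphic_maps_nsphere_euclidean_sphere[of "Basis :: (real^3) set" 3])
       (simp_all add: independent_Basis orthogonal_Basis)
  then have "nsphere 2 homeomorphic_space top_of_set (sphere (0 :: real^3) 1)"
    by (auto simp: homeomorphic_space_def)
  then have "(euclidean :: 'a topology) homeomorphic_space top_of_set (sphere (0 :: real^3) 1)"
    using assms homeomorphic_space_trans unfolding oriented_2_sphere_def by blast
  then obtain h :: "'a \<Rightarrow> real^3" and k where hk: "homeomorphic_maps euclidean (top_of_set (sphere 0 1)) h k"
    by (auto simp: homeomorphic_space_def)
  have "homeomorphism UNIV (sphere (0 :: real^3) 1) h k"
  proof (rule homeomorphismI)
    show "continuous_on UNIV h" "continuous_on (sphere 0 1) k" "range h \<subseteq> sphere 0 1"
      using hk[unfolded homeomorphic_maps_def] by (auto simp: continuous_map_in_subtopology)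
  qed (use hk[unfolded homeomorphic_maps_def] in auto)
  then show ?thesis by blast
qed

context
  fixes h :: "'a::topological_space \<Rightarrow> real^3" and k
  assumes hk: "homeomorphism UNIV (sphere 0 1) h k"
begin

lemma sphere_chart:
  shows sphere_chart_in: "h x \<in> sphere 0 1" and sphere_chart_inv: "k (h x) = x"
    and sphere_chart_inv': "v \<in> sphere 0 1 \<Longrightarrow> h (k v) = v"
    and sphere_chart_continuous: "continuous_on UNIV h" "continuous_on (sphere 0 1) k"
    and inj_sphere_chart: "inj h"
  using hk by (auto simp: homeomorphism_def intro: inj_on_inverseI)

lemma open_sphere_chart_image: "open S \<Longrightarrow> openin (top_of_set (sphere 0 1)) (h ` S)"
  using homeomorphism_imp_open_map[OF hk, of S] by simp

lemma compact_of_sphere_chart: "compact (UNIV :: 'a set)"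
  using compact_continuous_image[OF sphere_chart_continuous(2)] hk by (simp add: homeomorphism_def)

lemma hausdorff_of_sphere_chart:
  assumes "x \<noteq> (y :: 'a)" shows "\<exists>U V. open U \<and> open V \<and> x \<in> U \<and> y \<in> V \<and> U \<inter> V = {}"
proof -
  have "h x \<noteq> h y" using assms inj_sphere_chart by (simp add: inj_eq)
  from hausdorff[OF this] obtain U V where UV: "open U" "open V" "h x \<in> U" "h y \<in> V" "U \<inter> V = {}"
    by (elim exE conjE) (rule that)
  show ?thesis
  proof (intro exI conjI)
    show "open (h -` U)" "open (h -` V)"
      using UV(1,2) open_vimage[OF _ sphere_chart_continuous(1)] by blast+
    show "h -` U \<inter> h -` V = {}" using UV(5) by (simp flip: vimage_Int)
  qed (use UV in simp_all)
qed

lemma closed_image_of_sphere_chart: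
  fixes f :: "'a \<Rightarrow> 'a"
  assumes "continuous_on UNIV f" "closed S" shows "closed (f ` S)"
proof -
  have "compact S" using compact_Int_closed[OF compact_of_sphere_chart \<open>closed S\<close>] by simp
  then have "compact (h ` f ` S)"
    using continuous_on_subset[OF assms(1) subset_UNIV] continuous_on_subset[OF sphere_chart_continuous(1) subset_UNIV]
    by (intro compact_continuous_image)
  then have "closed (h -` h ` f ` S)"
    using closed_vimage[OF compact_imp_closed sphere_chart_continuous(1)] by blast
  then show ?thesis using inj_vimage_image_eq[OF inj_sphere_chart, of "f ` S"] by simp
qed

lemma zero_sets_of_sphere_chart: "closed_sets_are_zero_sets TYPE('a)"
  unfolding closed_sets_are_zero_sets_def
proof (intro allI impI)
  fix F :: "'a set" assume F: "closed F"
  show "\<exists>\<phi> :: 'a \<Rightarrow> real. continuous_on UNIV \<phi> \<and> (\<forall>x. 0 \<le> \<phi> x) \<and> F = {x. \<phi> x = 0}"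
  proof (cases "F = {}")
    case True
    then show ?thesis by (intro exI[of _ "\<lambda>_. 1"]) auto
  next
    case False
    have "compact F" using compact_Int_closed[OF compact_of_sphere_chart F] by simp
    then have cl: "closed (h ` F)"
      using compact_continuous_image[OF continuous_on_subset[OF sphere_chart_continuous(1)]] compact_imp_closed by blast
    have "infdist (h x) (h ` F) = 0 \<longleftrightarrow> x \<in> F" for x
      using in_closed_iff_infdist_zero[OF cl, of "h x"] False inj_image_mem_iff[OF inj_sphere_chart] by auto
    moreover have "continuous_on UNIV (\<lambda>x. infdist (h x) (h ` F))"
      by (intro continuous_on_infdist sphere_chart_continuous)
    ultimately show ?thesis by (intro exI[of _ "\<lambda>x. infdist (h x) (h ` F)"]) (auto simp: infdist_nonneg)
  qed
qed

text \<open>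
  The sphere is locally connected.
\<close>

lemma open_component_of_sphere_chart:
  assumes "open (S :: 'a set)" "W \<in> components S" shows "open W"
proof -
  have "\<exists>T. open T \<and> x \<in> T \<and> T \<subseteq> W" if "x \<in> W" for x
  proof -
    have "x \<in> S" using that in_components_subset[OF assms(2)] by blast
    then obtain u where u: "openin (top_of_set (sphere 0 1)) u" "connected u" "h x \<in> u" "u \<subseteq> h ` S"
      using locally_connected_sphere[of "0 :: real^3" 1] open_sphere_chart_image[OF assms(1)]
      unfolding locally_connected by (meson imageI)
    have us: "u \<subseteq> sphere 0 1" using openin_imp_subset[OF u(1)] .
    have eq: "k ` u = h -` u"
    proof (intro equalityI subsetI)
      fix x assume "x \<in> k ` u"
      then obtain v where "v \<in> u" "x = k v" by blast
      then show "x \<in> h -` u" using sphere_chart_inv'[of v] us by auto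
    next
      fix x assume "x \<in> h -` u"
      then show "x \<in> k ` u" using sphere_chart_inv[of x] by (intro image_eqI[of _ k "h x"]) simp_all
    qed
    have "open (h -` u)"
    proof -
      obtain T where T: "open T" "u = sphere 0 1 \<inter> T" using u(1) by (auto simp: openin_open)
      have "h -` u = h -` T" using T(2) sphere_chart_in by auto
      then show ?thesis using open_vimage[OF T(1) sphere_chart_continuous(1)] by simp
    qed
    moreover have "connected (h -` u)"
      using connected_continuous_image[OF continuous_on_subset[OF sphere_chart_continuous(2) us] u(2)] eq by simp
    moreover have "h -` u \<subseteq> S" using u(4) inj_sphere_chart by (auto dest: injD)
    ultimately show ?thesis using components_maximal[OF assms(2), of "h -` u"] that u(3) by blast
  qed
  then show ?thesis by (subst open_subopen) blast
qed

text \<open>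
  A Jordan curve is not the whole sphere, because the sphere is simply connected and the circle is
  not. Removing a point off the curve leaves a plane, and the Jordan curve theorem there shows that
  the complement of the curve is the union of that point and of two connected sets, and that
  every point of the curve is a limit of points of its bounded complementary domain.
\<close>

lemma Jordan_curve_of_sphere_chart:
  assumes "Jordan_curve (C :: 'a set)"
  shows "closed C" "interior C = {}" "finite (components (- C))"
proof -
  obtain \<gamma> where \<gamma>: "simple_path \<gamma>" "pathfinish \<gamma> = pathstart \<gamma>" "path_image \<gamma> = C"
    using assms unfolding Jordan_curve_def by blast
  have simple: "simple_path (g \<circ> \<gamma>)"
    if "continuous_on (path_image \<gamma>) g" "inj_on g (path_image \<gamma>)" for g :: "'a \<Rightarrow> 'b::topological_space"
  proof -
    have "\<gamma> s \<in> path_image \<gamma>" if "s \<in> {0..1}" for s using that by (auto simp: path_image_def)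
    then show ?thesis
      using \<gamma>(1) path_continuous_image[OF _ that(1)] inj_on_eq_iff[OF that(2)]
      unfolding simple_path_def loop_free_def by simp
  qed
  have loop: "pathfinish (g \<circ> \<gamma>) = pathstart (g \<circ> \<gamma>)" for g :: "'a \<Rightarrow> 'b::topological_space"
    using \<gamma>(2) by (simp add: pathfinish_def pathstart_def)
  have s1: "simple_path (h \<circ> \<gamma>)"
    by (rule simple[OF continuous_on_subset[OF sphere_chart_continuous(1)] inj_on_subset[OF inj_sphere_chart]]) auto
  have hC: "path_image (h \<circ> \<gamma>) = h ` C" by (simp add: path_image_compose \<gamma>(3))
  have "closed (h ` C)" using closed_path_image[of "h \<circ> \<gamma>"] s1 hC by (simp add: simple_path_imp_path)
  then have "closed (h -` (h ` C))" using sphere_chart_continuous(1) closed_vimage by blast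
  then show "closed C" using inj_vimage_image_eq[OF inj_sphere_chart, of C] by simp
  have "C \<noteq> UNIV"
  proof
    assume "C = UNIV"
    then have "h ` C = sphere 0 1" using hk by (simp add: homeomorphism_def)
    then have "sphere (0 :: real^3) 1 homeomorphic sphere (0 :: complex) 1"
      using homeomorphic_simple_path_image_circle[OF s1 loop, of 1 0] hC by simp
    then show False
      using homeomorphic_simply_connected_eq simply_connected_sphere_eq[of "0 :: real^3" 1]
        simply_connected_sphere_eq[of "0 :: complex" 1] by auto
  qed
  then obtain p where p: "p \<notin> C" by blast
  have "(sphere 0 1 \<inter> UNIV) - {h p} homeomorphic (UNIV :: complex set)"
    by (rule homeomorphic_punctured_affine_sphere_affine)
       (use sphere_chart_in[of p] in \<open>auto simp: aff_dim_UNIV\<close>)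
  then obtain s t where st: "homeomorphism (sphere 0 1 - {h p}) (UNIV :: complex set) s t"
    by (auto simp: homeomorphic_def)
  define e where "e = s \<circ> h"
  define e' where "e' = k \<circ> t"
  have hp: "h ` (- {p}) = sphere 0 1 - {h p}"
  proof -
    have "h ` (- {p}) = range h - {h p}" using inj_sphere_chart by (auto simp: inj_eq)
    then show ?thesis using hk by (simp add: homeomorphism_def)
  qed
  have e: "homeomorphism (- {p}) (UNIV :: complex set) e e'"
  proof -
    have "homeomorphism (- {p}) (sphere 0 1 - {h p}) h k"
      by (rule homeomorphism_of_subsets[OF hk]) (use hp in auto)
    then show ?thesis unfolding e_def e'_def using st by (rule homeomorphism_compose)
  qed
  have Cp: "C \<subseteq> - {p}" using p by blast
  have ce: "continuous_on (- {p}) e" and ce': "continuous_on UNIV e'" and e'e: "\<And>x. x \<noteq> p \<Longrightarrow> e' (e x) = x"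
    and e'p: "\<And>z. e' z \<noteq> p" and ee': "\<And>z. e (e' z) = z"
    using e by (auto simp: homeomorphism_def)
  have inje: "inj_on e (- {p})" by (rule inj_on_inverseI[of _ e']) (simp add: e'e)
  have s2: "simple_path (e \<circ> \<gamma>)"
    using simple[of e] \<gamma>(3) continuous_on_subset[OF ce Cp] inj_on_subset[OF inje Cp] by simp
  have eC: "path_image (e \<circ> \<gamma>) = e ` C" by (simp add: path_image_compose \<gamma>(3))
  obtain inner outer where io: "inner \<noteq> {}" "open inner" "connected inner" "outer \<noteq> {}" "open outer"
      "connected outer" "inner \<inter> outer = {}" "inner \<union> outer = - e ` C" "frontier inner = e ` C"
    using Jordan_curve[OF s2 loop] unfolding eC by metis
  show "interior C = {}"
  proof (rule ccontr)
    assume ne: "interior C \<noteq> {}"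
    have "openin (top_of_set (- {p})) (interior C)"
      using Cp interior_subset[of C] by (auto simp: openin_open intro!: exI[of _ "interior C"])
    then have op: "open (e ` interior C)" using homeomorphism_imp_open_map[OF e] by simp
    moreover have "e ` interior C \<subseteq> frontier inner" using io(9) interior_subset[of C] by auto
    moreover obtain x where "x \<in> interior C" using ne by blast
    ultimately have "e x \<in> closure inner" by (auto simp: frontier_def)
    then have "e ` interior C \<inter> inner \<noteq> {}"
      using op \<open>x \<in> interior C\<close> open_Int_closure_eq_empty[OF op] by blast
    then show False using io(8) interior_subset[of C] by blast
  qed
  have cover: "- C = {p} \<union> e' ` inner \<union> e' ` outer"
  proof (intro equalityI subsetI)
    fix x assume x: "x \<in> - C"
    show "x \<in> {p} \<union> e' ` inner \<union> e' ` outer"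
    proof (cases "x = p")
      case False
      then have "e x \<notin> e ` C" using x inj_onD[OF inje] Cp by blast
      then have "e x \<in> inner \<union> outer" using io(8) by blast
      then show ?thesis using e'e[OF False] by force
    qed simp
  next
    fix x assume "x \<in> {p} \<union> e' ` inner \<union> e' ` outer"
    moreover have "e' z \<notin> C" if "z \<in> inner \<union> outer" for z
    proof
      assume "e' z \<in> C"
      then have "z \<in> e ` C" using ee'[of z] by force
      then show False using that io(8) by blast
    qed
    ultimately show "x \<in> - C" using p by blast
  qed
  have con: "connected (e' ` inner)" "connected (e' ` outer)"
    using io(3,6) continuous_on_subset[OF ce'] by (auto intro!: connected_continuous_image)
  obtain zi zo where z: "zi \<in> inner" "zo \<in> outer" using io by blast
  have "components (- C) \<subseteq> connected_component_set (- C) ` {p, e' zi, e' zo}"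
  proof
    fix W assume "W \<in> components (- C)"
    then obtain x where x: "W = connected_component_set (- C) x" "x \<in> - C" by (auto simp: components_def)
    have eq: "W = connected_component_set (- C) y" if "connected T" "T \<subseteq> - C" "x \<in> T" "y \<in> T" for T y
      using that x(1) by (metis connected_component_eq connected_component_maximal mem_Collect_eq subsetD)
    from x(2) cover consider "x = p" | "x \<in> e' ` inner" | "x \<in> e' ` outer" by blast
    then show "W \<in> connected_component_set (- C) ` {p, e' zi, e' zo}"
    proof cases
      case 2
      then have "W = connected_component_set (- C) (e' zi)"
        using con(1) cover z by (intro eq[of "e' ` inner"]) auto
      then show ?thesis by blast
    next
      case 3
      then have "W = connected_component_set (- C) (e' zo)"
        using con(2) cover z by (intro eq[of "e' ` outer"]) auto
      then show ?thesis by blast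
    qed (use x in blast)
  qed
  then show "finite (components (- C))" by (rule finite_subset) simp
qed

end

section \<open>Expanding Thurston maps\<close>

text \<open>
  A Lebesgue number of the cover exceeds the diameters of all tiles of high level.
\<close>

lemma tiles_subordinate_to_cover:
  fixes f :: "'a::topological_space \<Rightarrow> 'a"
  assumes d: "Metric_space UNIV d" "Metric_space.mtopology UNIV d = euclidean"
    and cpt: "compact (UNIV :: 'a set)"
    and shrink: "(\<lambda>n. SUP T\<in>tiles f C n. diameter_wrt d T) \<longlonglongrightarrow> 0"
    and V: "finite_open_cover \<V>"
  shows "\<exists>m. \<forall>k\<ge>m. \<forall>T\<in>tiles f C k. \<exists>V\<in>\<V>. T \<subseteq> V"
proof -
  interpret Metric_space UNIV d by fact
  have cptM: "compactin mtopology UNIV" using cpt d(2) by simp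
  obtain e where e: "e > 0" "\<And>x. \<exists>V\<in>\<V>. mball x e \<subseteq> V"
    using lebesgue_number[OF cptM, of \<V>] V d(2) by (auto simp: finite_open_cover_def)
  have "mbounded UNIV" using compactin_imp_mbounded[OF cptM] .
  then obtain B where B: "\<And>x y. d x y \<le> B" unfolding mbounded_alt by auto
  have ne: "T \<noteq> {}" if "T \<in> tiles f C k" for T k
    using that in_components_nonempty by (auto simp: tiles_def)
  have bdd: "bdd_above ((\<lambda>(x, y). d x y) ` (T \<times> T))" for T
    by (rule bdd_aboveI[of _ B]) (use B in auto)
  have diam_le: "diameter_wrt d T \<le> B" if "T \<in> tiles f C k" for T k
    unfolding diameter_wrt_def using ne[OF that] B by (intro cSUP_least) auto
  have "\<forall>\<^sub>F n in sequentially. (SUP T\<in>tiles f C n. diameter_wrt d T) < e"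
    using shrink e(1) by (rule order_tendstoD)
  then obtain m where m: "\<And>n. n \<ge> m \<Longrightarrow> (SUP T\<in>tiles f C n. diameter_wrt d T) < e"
    by (auto simp: eventually_sequentially)
  have "\<exists>V\<in>\<V>. T \<subseteq> V" if T: "k \<ge> m" "T \<in> tiles f C k" for k T
  proof -
    obtain x where x: "x \<in> T" using ne[OF T(2)] by blast
    have "T \<subseteq> mball x e"
    proof
      fix y assume "y \<in> T"
      then have "d x y \<le> diameter_wrt d T"
        unfolding diameter_wrt_def using cSUP_upper[OF _ bdd, of "(x, y)" T] x by simp
      also have "\<dots> \<le> (SUP T\<in>tiles f C k. diameter_wrt d T)"
        using T(2) diam_le by (intro cSUP_upper bdd_aboveI[of _ B]) auto
      also have "\<dots> < e" using m[OF T(1)] .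
      finally show "y \<in> mball x e" by simp
    qed
    then show ?thesis using e(2)[of x] by blast
  qed
  then show ?thesis by blast
qed

theorem corollary1p3:
  fixes \<omega> :: "('a::topological_space) chain set" and f :: "'a \<Rightarrow> 'a"
  assumes "oriented_2_sphere euclidean \<omega>"
    and "expanding_Thurston_map \<omega> f"
    and "periodic_critical_points \<omega> f = {}"
  shows "upper_semicontinuous
           (subtopology weak_star_topology (invariant_measures f))
           (\<lambda>\<mu>. KS_entropy \<mu> f)"
proof -
  obtain h :: "'a \<Rightarrow> real^3" and k where hk: "homeomorphism UNIV (sphere 0 1) h k"
    using oriented_2_sphere_homeomorphism[OF assms(1)] by blast
  have f: "branched_covering \<omega> f" using assms(2) by (simp add: expanding_Thurston_map_def Thurston_map_def)
  then have cont: "continuous_on UNIV f" by (simp add: branched_covering_def)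
  obtain d C where d: "Metric_space UNIV d" "Metric_space.mtopology UNIV d = euclidean"
    and C: "Jordan_curve C" and shrink: "(\<lambda>n. SUP T\<in>tiles f C n. diameter_wrt d T) \<longlonglongrightarrow> 0"
    using assms(2) unfolding expanding_Thurston_map_def by blast
  note local = branched_covering_has_local_degree[OF f]
  interpret finite_branching_tiles f C "local_degree \<omega> f" "crit \<omega> f"
  proof
    show "compact (UNIV :: 'a set)" by (rule compact_of_sphere_chart[OF hk])
    show "\<exists>U V. open U \<and> open V \<and> x \<in> U \<and> y \<in> V \<and> U \<inter> V = {}" if "x \<noteq> y" for x y :: 'a
      by (rule hausdorff_of_sphere_chart[OF hk that])
    show "closed_sets_are_zero_sets TYPE('a)" by (rule zero_sets_of_sphere_chart[OF hk])
    show "continuous_on UNIV f" by fact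
    show "open (f ` S)" if "open S" for S by (rule branched_covering_open_map[OF f that])
    show "closed (f ` S)" if "closed S" for S by (rule closed_image_of_sphere_chart[OF hk cont that])
    show "open W" if "open S" "W \<in> components S" for S W :: "'a set"
      by (rule open_component_of_sphere_chart[OF hk that])
    show "closed C" "interior C = {}" "finite (components (- C))"
      using Jordan_curve_of_sphere_chart[OF hk C] by blast+
    show "\<exists>G. open G \<and> x \<in> G \<and> (\<forall>y. finite (f -` {y} \<inter> G) \<and> card (f -` {y} \<inter> G) \<le> local_degree \<omega> f x)" for x
      by (rule has_local_degree_multiplicity_le[OF local])
    show "1 \<le> local_degree \<omega> f x" for x using local[of x] by (simp add: has_local_degree_def)
    then show "local_degree \<omega> f x = 1" if "x \<notin> crit \<omega> f" for x
      using that by (simp add: crit_def) (metis One_nat_def le_antisym not_less_eq_eq numeral_2_eq_2)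
    show "finite (crit \<omega> f)" by (rule finite_crit[OF compact_of_sphere_chart[OF hk] f])
    show "(f ^^ n) x \<noteq> x" if "x \<in> crit \<omega> f" "1 \<le> n" for x n
      using assms(3) that by (auto simp: periodic_critical_points_def)
    show "\<exists>m. \<forall>k\<ge>m. \<forall>T\<in>tiles f C k. \<exists>V\<in>\<V>. T \<subseteq> V" if "finite_open_cover \<V>" for \<V>
      by (rule tiles_subordinate_to_cover[OF d compact_of_sphere_chart[OF hk] shrink that])
  qed
  show ?thesis
    by (rule KS_entropy_upper_semicontinuous[OF compact_space zero_sets cont asymptotically_h_expansive])
qed

end
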